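(* Let $\mathcal{L}\subseteq\{+,-,0\}^E$ be the set of covectors of a loopless oriented matroid on a finite ground set $E$ with set of topes $\mathcal{T}$, let $\mathbb{K}$ be a field, and let $\mathfrak{V}$ be the Varchenko matrix of $\mathcal{L}$ over $\mathbb{K}[U_e\mid e\in E]$. Let $\emptyset\neq E'\subseteq E$ and $\epsilon=(\epsilon_e)_{e\in E'}\in\{+,-\}^{E'}$ be such that, with $\epsilon^{+}=\{e\in E'\mid \epsilon_e=+\}$ and $\epsilon^-=\{e\in E'\mid\epsilon_e=-\}$, the supertope $\mathcal{T}(\epsilon^+,\epsilon^-)$ is a closed supertope. Let $\mathfrak{V}_\epsilon$ be the submatrix of $\mathfrak{V}$ obtained by selecting all rows and columns indexed by topes $P\in\mathcal{T}$ with $P_e=\epsilon_e$ for all $e\in E'$. Then there exist nonnegative integers $b_{F,\epsilon}$ such that $$\det(\mathfrak{V}_\epsilon)=\prod_{\substack{F\in\mathcal{L}\\ F_e\neq 0\text{ for all }e\in E'}}\bigl(1-a(F)^2\bigr)^{b_{F,\epsilon}},$$ with the convention $0^0=1$.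
   Context: Oriented matroids are given by their covector sets (standard covector axioms). Covectors are ordered componentwise by $0<+$, $0<-$; topes are the maximal covectors. Loopless means that for every $e\in E$ some covector $X$ has $X_e\ne0$. For topes $P,Q$, $\mathrm{Sep}(P,Q)=\{e\in E\mid P_e=-Q_e\neq 0\}$. The Varchenko matrix $\mathfrak{V}$ has rows and columns indexed by $\mathcal{T}$, with entries $\mathfrak{V}_{P,Q}=\prod_{e\in \mathrm{Sep}(P,Q)}U_e$. For $F\in\mathcal{L}$, $a(F)=\prod_{e\in E,\,F_e=0}U_e$. For disjoint $S^+,S^-\subseteq E$ with $S^+\cup S^-\neq\emptyset$, the supertope is $\mathcal{T}(S^+,S^-)=\{T\in\mathcal{T}\mid T_f=+\ \forall f\in S^+,\ T_f=-\ \forall f\in S^-\}$. It is a closed supertope if for every supertope $\mathcal{T}(\tilde S^+,\tilde S^-)$ with $S^+\subseteq\tilde S^+$, $S^-\subseteq\tilde S^-$ and $(S^+,S^-)\neq(\tilde S^+,\tilde S^-)$ one has $\mathcal{T}(\tilde S^+,\tilde S^-)\subsetneq\mathcal{T}(S^+,S^-)$. *)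

theory Defs
  imports
    "HOL-Library.Poly_Mapping"
    "HOL-Analysis.Determinants"
begin

section \<open>Sign vectors\<close>

datatype signum = Zero | Pos | Neg

instantiation signum :: "{zero, uminus}"
begin

definition zero_signum :: signum where
  "0 = Zero"

fun uminus_signum :: "signum \<Rightarrow> signum" where
  "- Zero = Zero"
| "- Pos = Neg"
| "- Neg = Pos"

instance ..

end

instantiation signum :: order
begin

definition less_eq_signum :: "signum \<Rightarrow> signum \<Rightarrow> bool" where
  "less_eq_signum s t \<longleftrightarrow> s = 0 \<or> s = t"

definition less_signum :: "signum \<Rightarrow> signum \<Rightarrow> bool" where
  "less_signum s t \<longleftrightarrow> s = 0 \<and> t \<noteq> 0"

instance
  by standard (auto simp: less_eq_signum_def less_signum_def)

end

text \<open>
  A sign vector on \<open>E\<close> is a function on the whole type \<open>'e\<close> that vanishes outside \<open>E\<close>.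
  Negation (\<open>- X\<close>) and the componentwise order (\<open>X \<le> Y\<close>) are then the
  library's pointwise operations on functions.
\<close>

type_synonym 'e signvec = "'e \<Rightarrow> signum"

definition Sep :: "'e set \<Rightarrow> 'e signvec \<Rightarrow> 'e signvec \<Rightarrow> 'e set" where
  "Sep E X Y = {e \<in> E. X e = - Y e \<and> X e \<noteq> 0}"

definition comp_sv :: "'e signvec \<Rightarrow> 'e signvec \<Rightarrow> 'e signvec" where
  "comp_sv X Y = (\<lambda>e. if X e \<noteq> 0 then X e else Y e)"

section \<open>Oriented matroids\<close>

locale oriented_matroid =
  fixes E :: "'e set" and L :: "'e signvec set"
  assumes finite_ground: "finite E"
    and covector_outside: "X \<in> L \<Longrightarrow> e \<notin> E \<Longrightarrow> X e = 0"
    and covector_zero: "(\<lambda>e. 0) \<in> L"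
    and covector_uminus: "X \<in> L \<Longrightarrow> - X \<in> L"
    and covector_comp: "X \<in> L \<Longrightarrow> Y \<in> L \<Longrightarrow> comp_sv X Y \<in> L"
    and covector_elim: "X \<in> L \<Longrightarrow> Y \<in> L \<Longrightarrow> e \<in> Sep E X Y \<Longrightarrow>
      \<exists>Z\<in>L. Z e = 0 \<and> (\<forall>f \<in> E - Sep E X Y. Z f = comp_sv X Y f)"

definition loopless :: "'e set \<Rightarrow> 'e signvec set \<Rightarrow> bool" where
  "loopless E L \<longleftrightarrow> (\<forall>e\<in>E. \<exists>X\<in>L. X e \<noteq> 0)"

definition topes :: "'e signvec set \<Rightarrow> 'e signvec set" where
  "topes L = {T \<in> L. \<forall>X\<in>L. T \<le> X \<longrightarrow> X = T}"

definition supertope :: "'e signvec set \<Rightarrow> 'e set \<Rightarrow> 'e set \<Rightarrow> 'e signvec set" where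
  "supertope L Sp Sm = {T \<in> topes L. (\<forall>f\<in>Sp. T f = Pos) \<and> (\<forall>f\<in>Sm. T f = Neg)}"

definition supertope_index :: "'e set \<Rightarrow> 'e set \<Rightarrow> 'e set \<Rightarrow> bool" where
  "supertope_index E Sp Sm \<longleftrightarrow> Sp \<subseteq> E \<and> Sm \<subseteq> E \<and> Sp \<inter> Sm = {} \<and> Sp \<union> Sm \<noteq> {}"

text \<open>
  Closedness is a property of the pair \<open>(Sp, Sm)\<close>, not just of the set of topes it defines.
\<close>

definition closed_supertope :: "'e set \<Rightarrow> 'e signvec set \<Rightarrow> 'e set \<Rightarrow> 'e set \<Rightarrow> bool" where
  "closed_supertope E L Sp Sm \<longleftrightarrow>
     supertope_index E Sp Sm \<and>
     (\<forall>Sp' Sm'. supertope_index E Sp' Sm' \<longrightarrow> Sp \<subseteq> Sp' \<longrightarrow> Sm \<subseteq> Sm' \<longrightarrow>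
        (Sp, Sm) \<noteq> (Sp', Sm') \<longrightarrow> supertope L Sp' Sm' \<subset> supertope L Sp Sm)"

section \<open>The Varchenko matrix\<close>

text \<open>
  Polynomials over \<open>'k\<close> in variables indexed by \<open>'e\<close>: finitely supported maps from monomials
  (exponent vectors) to coefficients. All polynomials below only involve variables indexed by \<open>E\<close>,
  i.e. they lie in the subring of polynomials in \<open>U\<^sub>e\<close> with \<open>e \<in> E\<close>.
\<close>

type_synonym ('e, 'k) mpoly = "('e \<Rightarrow>\<^sub>0 nat) \<Rightarrow>\<^sub>0 'k"

definition var_U :: "'e \<Rightarrow> ('e, 'k::field) mpoly" where
  "var_U e = Poly_Mapping.single (Poly_Mapping.single e 1) 1"

definition varchenko :: "'e set \<Rightarrow> 'e signvec \<Rightarrow> 'e signvec \<Rightarrow> ('e, 'k::field) mpoly" where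
  "varchenko E P Q = (\<Prod>e \<in> Sep E P Q. var_U e)"

definition a_poly :: "'e set \<Rightarrow> 'e signvec \<Rightarrow> ('e, 'k::field) mpoly" where
  "a_poly E F = (\<Prod>e \<in> {e \<in> E. F e = 0}. var_U e)"

text \<open>
  The determinant of the square matrix with rows and columns indexed by a finite set \<open>S\<close>,
  with entries \<open>A i j\<close> for \<open>i, j \<in> S\<close> (Leibniz formula). Restricting \<open>S\<close>
  yields principal minors.
\<close>

definition det_on :: "'i set \<Rightarrow> ('i \<Rightarrow> 'i \<Rightarrow> 'r::comm_ring_1) \<Rightarrow> 'r" where
  "det_on S A = (\<Sum>p | p permutes S. of_int (sign p) * (\<Prod>i\<in>S. A i (p i)))"

lemma det_on_UNIV: "det_on UNIV (\<lambda>i j. A $ i $ j) = det A"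
  by (simp add: det_on_def det_def)

end

theory Submission
  imports Defs
begin

text \<open>
  Let \<open>C\<close> be a cone of topes, given by prescribed nonzero signs on a set \<open>A\<close>, and let \<open>V\<close> be the
  Varchenko matrix with rows and columns indexed by \<open>C\<close>. Pick an element \<open>e\<close> outside \<open>A\<close>. The wall
  \<open>e = 0\<close> cuts \<open>C\<close> into two half cones, each of which is again a cone, with one more prescribed
  sign. The heart of the proof is a factorization \<open>V = M D\<close>, in which \<open>D\<close> is block diagonal with the
  Varchenko matrices of the two half cones as blocks and \<open>det M\<close> is a product of factors
  \<open>1 - a(F)\<^sup>2\<close> over faces \<open>F\<close> of the wall that have no zero in \<open>A\<close>. Induction on the number of elements
  outside \<open>A\<close> then gives the theorem; once \<open>A = E\<close>, a cone has at most one tope.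

  To find \<open>M\<close>, the row of \<open>V\<close> at a tope \<open>Q\<close> has to be written, in the columns \<open>P\<close> of a half cone,
  as a combination of the rows of that half cone. Let \<open>s\<close> be the weight on covectors with
  \<open>\<Sum>G \<ge> F. s G = 1\<close> for every \<open>F\<close>; it is a sign given by the parity of the corank. It behaves like an
  Euler characteristic: its sum over all covectors with prescribed signs on some set is \<open>1\<close>, if
  there are any (\<open>euler_weight_sum\<close>). A path from \<open>Q\<close> to \<open>P\<close> through a third tope \<open>R\<close> crosses
  twice the elements that separate \<open>R\<close> from both, so \<open>V Q R * V R P\<close> is \<open>V Q P\<close> times the squares of
  their variables. For \<open>R = F \<circ> (-Q)\<close>, where \<open>F\<close> runs through the covectors of the cone that have
  the same sign as \<open>P\<close> at \<open>e\<close>, the sum of these squares weighted by \<open>s F\<close> collapses to \<open>1\<close>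
  (\<open>euler_weight_mixed_sum\<close>). Hence \<open>M Q R\<close> is \<open>V Q R\<close> times the sum of \<open>s F\<close> over the
  covectors \<open>F\<close> with \<open>F \<circ> (-Q) = R\<close> that do not lie in the wall (\<open>wall_matrix_factorization\<close>).

  To compute \<open>det M\<close>, note that without the condition on \<open>e\<close> the last sum would be \<open>1\<close> for \<open>Q = R\<close>
  and \<open>0\<close> otherwise (\<open>euler_weight_fibre\<close>). So \<open>M\<close> differs from the identity matrix only by sums
  over covectors in the wall, and these are controlled by the greatest face of a tope that lies in
  the wall. A nonzero entry \<open>M Q R\<close> with \<open>Q \<noteq> R\<close> forces the wall face of \<open>R\<close> to have fewer zeros than that of
  \<open>Q\<close>, unless \<open>R\<close> is the mirror image of \<open>Q\<close> in a common wall face \<open>G\<close>; in that case the entry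
  is \<open>a(G)\<close> up to sign (\<open>wall_coeff_zeros\<close>, \<open>wall_coeff_same_zeros\<close>). Ordered by the number of these zeros,
  \<open>M\<close> is block triangular, with blocks of size one with entry \<open>1\<close> and blocks of size two
  with determinant \<open>1 - a(G)\<^sup>2\<close>.
\<close>

section \<open>Determinants over finite index sets\<close>

lemma det_on_cong:
  assumes "\<And>i j. i \<in> S \<Longrightarrow> j \<in> S \<Longrightarrow> A i j = B i j"
  shows "det_on S A = det_on S B"
  unfolding det_on_def
  by (intro sum.cong refl arg_cong[where f="\<lambda>x. _ * x"] prod.cong)
    (auto simp: assms permutes_in_image)

text \<open>
  Right multiplication by the transposition exchanges even and odd permutations, so the two halves
  of the sum cancel. Showing only that the sum equals its own negative would not suffice in
  characteristic two.
\<close>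

lemma alternating_sum_eq_0:
  fixes f :: "('i \<Rightarrow> 'i) \<Rightarrow> 'r::comm_ring_1"
  assumes fin: "finite S" and ij: "i \<in> S" "j \<in> S" "i \<noteq> j"
    and f: "\<And>p. p permutes S \<Longrightarrow> f (p \<circ> Transposition.transpose i j) = f p"
  shows "(\<Sum>p | p permutes S. of_int (sign p) * f p) = 0"
proof -
  let ?T = "Transposition.transpose i j"
  let ?P = "{p. p permutes S}"
  let ?Ev = "{p \<in> ?P. evenperm p}" and ?Od = "{p \<in> ?P. \<not> evenperm p}"
  have finP: "finite ?P"
    using fin by (rule finite_permutations)
  have T: "?T permutes S"
    using ij by (simp add: permutes_swap_id)
  have perm: "permutation p" if "p permutes S" for p
    using that fin permutation_permutes by blast
  have flip: "evenperm (p \<circ> ?T) \<longleftrightarrow> \<not> evenperm p" if "p permutes S" for p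
    using evenperm_comp[OF perm[OF that] perm[OF T]] ij by (simp add: evenperm_swap)
  have inv: "(p \<circ> ?T) \<circ> ?T = p" for p
    by (simp add: comp_assoc)
  have bij: "bij_betw (\<lambda>p. p \<circ> ?T) ?Ev ?Od"
    by (rule bij_betw_byWitness[where f'="\<lambda>p. p \<circ> ?T"])
      (use T flip inv permutes_compose in \<open>auto simp: comp_assoc\<close>)
  have "(\<Sum>p\<in>?P. of_int (sign p) * f p)
      = (\<Sum>p\<in>?Ev. of_int (sign p) * f p) + (\<Sum>p\<in>?Od. of_int (sign p) * f p)"
    using finP by (subst sum.union_disjoint[symmetric]) (auto intro: sum.cong)
  also have "(\<Sum>p\<in>?Od. of_int (sign p) * f p)
      = (\<Sum>p\<in>?Ev. of_int (sign (p \<circ> ?T)) * f (p \<circ> ?T))"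
    by (rule sum.reindex_bij_betw[OF bij, symmetric])
  also have "\<dots> = (\<Sum>p\<in>?Ev. - (of_int (sign p) * f p))"
    by (rule sum.cong) (auto simp: f sign_def flip)
  finally show ?thesis
    by (simp add: sum_negf)
qed

text \<open>
  Expanding the product of the row sums gives one term for every function \<open>g\<close> from \<open>S\<close> to \<open>S\<close>. If
  \<open>g\<close> is not injective, the term contains the determinant of a matrix with two equal rows; otherwise
  \<open>g\<close> is a permutation and only reorders the rows of \<open>B\<close>.
\<close>

lemma det_on_mult:
  fixes A B :: "'i \<Rightarrow> 'i \<Rightarrow> 'r::comm_ring_1"
  assumes fin: "finite S"
  shows "det_on S (\<lambda>i j. \<Sum>k\<in>S. A i k * B k j) = det_on S A * det_on S B"
proof -
  let ?P = "{p. p permutes S}"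
  define h where "h g = (\<Sum>p\<in>?P. of_int (sign p) * (\<Prod>i\<in>S. B (g i) (p i)))" for g
  have h_noninj: "h g = 0" if g: "\<not> inj_on g S" for g
  proof -
    obtain i j where ij: "i \<in> S" "j \<in> S" "i \<noteq> j" "g i = g j"
      using g by (auto simp: inj_on_def)
    have T: "Transposition.transpose i j permutes S"
      using ij by (simp add: permutes_swap_id)
    have gT: "g (Transposition.transpose i j k) = g k" for k
      using ij by (auto simp: Transposition.transpose_def)
    show ?thesis
      unfolding h_def
    proof (rule alternating_sum_eq_0[OF fin ij(1-3)])
      fix p
      have "(\<Prod>k\<in>S. B (g k) (p k)) = (\<Prod>k\<in>S. B (g (Transposition.transpose i j k)) (p (Transposition.transpose i j k)))"
        by (rule prod.reindex_bij_betw[OF permutes_imp_bij[OF T], symmetric])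
      thus "(\<Prod>k\<in>S. B (g k) ((p \<circ> Transposition.transpose i j) k)) = (\<Prod>k\<in>S. B (g k) (p k))"
        by (simp add: gT)
    qed
  qed
  have h_perm: "h q = of_int (sign q) * det_on S B" if q: "q permutes S" for q
  proof -
    have "h q = (\<Sum>p\<in>?P. of_int (sign (p \<circ> q)) * (\<Prod>i\<in>S. B (q i) ((p \<circ> q) i)))"
      unfolding h_def by (rule sum_permutations_compose_right[OF q])
    also have "\<dots> = (\<Sum>p\<in>?P. of_int (sign q) * (of_int (sign p) * (\<Prod>i\<in>S. B i (p i))))"
    proof (rule sum.cong[OF refl])
      fix p assume "p \<in> ?P"
      hence "sign (p \<circ> q) = sign p * sign q"
        using q fin permutation_permutes by (intro sign_compose) blast+
      moreover have "(\<Prod>i\<in>S. B (q i) (p (q i))) = (\<Prod>i\<in>S. B i (p i))"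
        by (rule prod.reindex_bij_betw[OF permutes_imp_bij[OF q]])
      ultimately show "of_int (sign (p \<circ> q)) * (\<Prod>i\<in>S. B (q i) ((p \<circ> q) i))
          = of_int (sign q) * (of_int (sign p) * (\<Prod>i\<in>S. B i (p i)))"
        by simp
    qed
    finally show ?thesis
      by (simp add: det_on_def sum_distrib_left)
  qed
  \<comment> \<open>Permutations are the identity outside \<open>S\<close>, extensional functions are undefined there.\<close>
  have bij: "bij_betw (\<lambda>q. restrict q S) ?P {g \<in> S \<rightarrow>\<^sub>E S. inj_on g S}"
  proof (rule bij_betw_byWitness[where f'="\<lambda>g. restrict_id g S"])
    show "\<forall>q\<in>?P. restrict_id (restrict q S) S = q"
      by (auto simp: fun_eq_iff restrict_id_def permutes_not_in)
    show "\<forall>g\<in>{g \<in> S \<rightarrow>\<^sub>E S. inj_on g S}. restrict (restrict_id g S) S = g"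
      by (auto simp: fun_eq_iff restrict_id_def PiE_def extensional_def)
    show "(\<lambda>q. restrict q S) ` ?P \<subseteq> {g \<in> S \<rightarrow>\<^sub>E S. inj_on g S}"
    proof (rule image_subsetI)
      fix q assume "q \<in> ?P"
      hence q: "q permutes S"
        by simp
      hence "inj_on q S"
        using permutes_inj inj_on_subset by blast
      thus "restrict q S \<in> {g \<in> S \<rightarrow>\<^sub>E S. inj_on g S}"
        using q by (simp add: permutes_in_image inj_on_restrict_eq)
    qed
    show "(\<lambda>g. restrict_id g S) ` {g \<in> S \<rightarrow>\<^sub>E S. inj_on g S} \<subseteq> ?P"
    proof clarify
      fix g assume g: "g \<in> S \<rightarrow>\<^sub>E S" "inj_on g S"
      hence "g ` S \<subseteq> S"
        by auto
      hence "bij_betw g S S"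
        using g(2) endo_inj_surj[OF fin] by (simp add: bij_betw_def)
      thus "restrict_id g S permutes S"
        by (rule permutes_restrict_id)
    qed
  qed
  have "det_on S (\<lambda>i j. \<Sum>k\<in>S. A i k * B k j)
      = (\<Sum>p\<in>?P. of_int (sign p) * (\<Sum>g\<in>S \<rightarrow>\<^sub>E S. \<Prod>i\<in>S. A i (g i) * B (g i) (p i)))"
    unfolding det_on_def using fin by (subst prod_sum_PiE) auto
  also have "\<dots> = (\<Sum>g\<in>S \<rightarrow>\<^sub>E S. (\<Prod>i\<in>S. A i (g i)) * h g)"
    unfolding h_def sum_distrib_left
    by (subst sum.swap) (simp add: prod.distrib mult_ac)
  also have "\<dots> = (\<Sum>g | g \<in> S \<rightarrow>\<^sub>E S \<and> inj_on g S. (\<Prod>i\<in>S. A i (g i)) * h g)"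
    by (rule sum.mono_neutral_right) (use fin h_noninj in \<open>auto intro: finite_PiE\<close>)
  also have "\<dots> = (\<Sum>q\<in>?P. (\<Prod>i\<in>S. A i (restrict q S i)) * h (restrict q S))"
    using sum.reindex_bij_betw[OF bij, of "\<lambda>g. (\<Prod>i\<in>S. A i (g i)) * h g", symmetric]
    by (simp only: mem_Collect_eq)
  also have "\<dots> = (\<Sum>q\<in>?P. (\<Prod>i\<in>S. A i (q i)) * h q)"
    by (simp add: h_def cong: prod.cong)
  also have "\<dots> = det_on S A * det_on S B"
    unfolding det_on_def[of S A] sum_distrib_right
    by (intro sum.cong refl) (simp add: h_perm mult_ac)
  finally show ?thesis .
qed

text \<open>
  Only the permutations that map \<open>A\<close> into itself contribute, and such a permutation is the product
  of a permutation of \<open>A\<close> and one of its complement in \<open>S\<close>.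
\<close>

lemma det_on_block_triangular:
  fixes M :: "'i \<Rightarrow> 'i \<Rightarrow> 'r::comm_ring_1"
  assumes fin: "finite S" and AS: "A \<subseteq> S"
    and zero: "\<And>i j. i \<in> A \<Longrightarrow> j \<in> S - A \<Longrightarrow> M i j = 0"
  shows "det_on S M = det_on A M * det_on (S - A) M"
proof -
  let ?B = "S - A"
  let ?P = "{p. p permutes S}"
  let ?f = "\<lambda>p. of_int (sign p) * (\<Prod>i\<in>S. M i (p i))"
  have finA: "finite A" and finB: "finite ?B"
    using fin AS finite_subset by auto
  have bij: "bij_betw (\<lambda>(p, q). p \<circ> q) ({p. p permutes A} \<times> {q. q permutes ?B})
      {p \<in> ?P. p ` A \<subseteq> A}"
  proof (rule bij_betw_byWitness[where f'="\<lambda>p. (restrict_id p A, restrict_id p ?B)"])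
    show "\<forall>a\<in>{p. p permutes A} \<times> {q. q permutes ?B}.
        (restrict_id ((\<lambda>(p, q). p \<circ> q) a) A, restrict_id ((\<lambda>(p, q). p \<circ> q) a) ?B) = a"
    proof (rule ballI)
      fix a assume "a \<in> {p. p permutes A} \<times> {q. q permutes ?B}"
      then obtain p q where a: "a = (p, q)" and p: "p permutes A" and q: "q permutes ?B"
        by auto
      have qB: "q x \<notin> A" if "x \<in> S" "x \<notin> A" for x
        using permutes_in_image[OF q, of x] that by auto
      have "restrict_id (p \<circ> q) A = p" "restrict_id (p \<circ> q) ?B = q"
        using permutes_not_in[OF p] permutes_not_in[OF q] qB
        by (auto simp: fun_eq_iff restrict_id_def)
      thus "(restrict_id ((\<lambda>(p, q). p \<circ> q) a) A, restrict_id ((\<lambda>(p, q). p \<circ> q) a) ?B) = a"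
        by (simp add: a)
    qed
    show "\<forall>p\<in>{p \<in> ?P. p ` A \<subseteq> A}. (\<lambda>(p, q). p \<circ> q) (restrict_id p A, restrict_id p ?B) = p"
    proof (rule ballI)
      fix p assume "p \<in> {p \<in> ?P. p ` A \<subseteq> A}"
      hence p: "p permutes S" "p ` A \<subseteq> A"
        by auto
      hence "p ` A = A"
        using finA by (metis endo_inj_surj inj_on_subset permutes_inj subset_UNIV)
      hence "p x \<in> A \<longleftrightarrow> x \<in> A" for x
        using permutes_inj[OF p(1)] by (metis image_iff inj_eq)
      thus "(\<lambda>(p, q). p \<circ> q) (restrict_id p A, restrict_id p ?B) = p"
        using p(1) AS by (auto simp: fun_eq_iff restrict_id_def permutes_not_in)
    qed
    show "(\<lambda>(p, q). p \<circ> q) ` ({p. p permutes A} \<times> {q. q permutes ?B}) \<subseteq> {p \<in> ?P. p ` A \<subseteq> A}"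
    proof (rule image_subsetI)
      fix a assume "a \<in> {p. p permutes A} \<times> {q. q permutes ?B}"
      then obtain p q where a: "a = (p, q)" and p: "p permutes A" and q: "q permutes ?B"
        by auto
      have "p permutes S" "q permutes S"
        using permutes_subset[OF p AS] permutes_subset[OF q] by auto
      moreover have "q x = x" if "x \<in> A" for x
        using q that by (simp add: permutes_not_in)
      ultimately show "(\<lambda>(p, q). p \<circ> q) a \<in> {p \<in> ?P. p ` A \<subseteq> A}"
        using p by (auto simp: a permutes_compose permutes_in_image)
    qed
    show "(\<lambda>p. (restrict_id p A, restrict_id p ?B)) ` {p \<in> ?P. p ` A \<subseteq> A}
        \<subseteq> {p. p permutes A} \<times> {q. q permutes ?B}"
    proof (rule image_subsetI)
      fix p assume "p \<in> {p \<in> ?P. p ` A \<subseteq> A}"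
      hence p: "p permutes S" "p ` A \<subseteq> A"
        by auto
      have inj: "inj_on p X" for X
        using permutes_inj[OF p(1)] inj_on_subset by blast
      have A: "p ` A = A"
        using finA p(2) inj by (metis endo_inj_surj)
      have "p ` ?B = ?B"
        using A permutes_image[OF p(1)] permutes_inj[OF p(1)] by (metis image_set_diff)
      with A show "(restrict_id p A, restrict_id p ?B) \<in> {p. p permutes A} \<times> {q. q permutes ?B}"
        using inj by (auto intro!: permutes_restrict_id simp: bij_betw_def)
    qed
  qed
  have "det_on S M = sum ?f {p \<in> ?P. p ` A \<subseteq> A}"
    unfolding det_on_def
  proof (rule sum.mono_neutral_right)
    show "\<forall>p\<in>?P - {p \<in> ?P. p ` A \<subseteq> A}. ?f p = 0"
    proof (rule ballI)
      fix p assume "p \<in> ?P - {p \<in> ?P. p ` A \<subseteq> A}"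
      then obtain i where p: "p permutes S" and i: "i \<in> A" "p i \<notin> A"
        by auto
      hence "M i (p i) = 0"
        using AS by (intro zero) (auto simp: permutes_in_image)
      thus "?f p = 0"
        using i AS prod_zero[OF fin, of "\<lambda>i. M i (p i)"] by (metis mult_zero_right subsetD)
    qed
  qed (use fin in \<open>auto simp: finite_permutations\<close>)
  also have "\<dots> = (\<Sum>(p, q)\<in>{p. p permutes A} \<times> {q. q permutes ?B}. ?f (p \<circ> q))"
    using sum.reindex_bij_betw[OF bij, of ?f] by (simp add: case_prod_unfold)
  also have "\<dots> = (\<Sum>(p, q)\<in>{p. p permutes A} \<times> {q. q permutes ?B}.
      (of_int (sign p) * (\<Prod>i\<in>A. M i (p i))) * (of_int (sign q) * (\<Prod>i\<in>?B. M i (q i))))"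
  proof (rule sum.cong[OF refl], clarify)
    fix p q assume p: "p permutes A" and q: "q permutes ?B"
    have "sign (p \<circ> q) = sign p * sign q"
      using p q finA finB permutation_permutes by (intro sign_compose) blast+
    moreover have "(\<Prod>i\<in>S. M i ((p \<circ> q) i))
        = (\<Prod>i\<in>A. M i ((p \<circ> q) i)) * (\<Prod>i\<in>?B. M i ((p \<circ> q) i))"
      using prod.subset_diff[OF AS fin, of "\<lambda>i. M i ((p \<circ> q) i)"] by (simp only: mult.commute)
    moreover have "(\<Prod>i\<in>A. M i ((p \<circ> q) i)) = (\<Prod>i\<in>A. M i (p i))"
      using q by (intro prod.cong) (auto simp: permutes_not_in)
    moreover have "(\<Prod>i\<in>?B. M i ((p \<circ> q) i)) = (\<Prod>i\<in>?B. M i (q i))"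
    proof (intro prod.cong refl)
      fix i assume "i \<in> ?B"
      hence "q i \<notin> A"
        using permutes_in_image[OF q, of i] by blast
      thus "M i ((p \<circ> q) i) = M i (q i)"
        using p by (simp add: permutes_not_in)
    qed
    ultimately show "?f (p \<circ> q) = (of_int (sign p) * (\<Prod>i\<in>A. M i (p i)))
        * (of_int (sign q) * (\<Prod>i\<in>?B. M i (q i)))"
      by simp
  qed
  also have "\<dots> = det_on A M * det_on ?B M"
    by (simp add: det_on_def sum_product sum.cartesian_product)
  finally show ?thesis .
qed

lemma det_on_empty [simp]: "det_on {} M = 1"
  by (simp add: det_on_def)

lemma det_on_singleton [simp]: "det_on {i} M = M i i"
  by (simp add: det_on_def)

lemma det_on_pair:
  assumes "i \<noteq> j"
  shows "det_on {i, j} M = M i i * M j j - M i j * M j i"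
proof -
  have "Transposition.transpose i j \<noteq> id"
    using assms by (metis id_apply transpose_apply_first)
  moreover have "{p. p permutes {i, j}} = {id, Transposition.transpose i j}"
    using assms by (auto simp: permutes_doubleton_iff)
  ultimately show ?thesis
    using assms by (simp add: det_on_def sign_swap_id)
qed

section \<open>Products of powers of prescribed factors\<close>

text \<open>
  The exponents themselves are never needed; only their existence is carried through the induction.
\<close>

definition power_product :: "'i set \<Rightarrow> ('i \<Rightarrow> 'r::comm_ring_1) \<Rightarrow> 'r \<Rightarrow> bool" where
  "power_product S f D \<longleftrightarrow> (\<exists>b :: 'i \<Rightarrow> nat. D = (\<Prod>i\<in>S. f i ^ b i))"

lemma power_product_1: "power_product S f 1"
  unfolding power_product_def by (intro exI[of _ "\<lambda>_. 0"]) simp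

lemma power_product_mult:
  assumes "power_product S f D" "power_product S f D'"
  shows "power_product S f (D * D')"
proof -
  obtain b b' where "D = (\<Prod>i\<in>S. f i ^ b i)" "D' = (\<Prod>i\<in>S. f i ^ b' i)"
    using assms by (auto simp: power_product_def)
  hence "D * D' = (\<Prod>i\<in>S. f i ^ (b i + b' i))"
    by (simp add: power_add prod.distrib)
  thus ?thesis
    unfolding power_product_def by (rule exI[of _ "\<lambda>i. b i + b' i"])
qed

lemma power_product_mono:
  assumes "power_product S f D" "S \<subseteq> T" "finite T"
  shows "power_product T f D"
proof -
  obtain b where b: "D = (\<Prod>i\<in>S. f i ^ b i)"
    using assms by (auto simp: power_product_def)
  have "D = (\<Prod>i\<in>T. f i ^ (if i \<in> S then b i else 0))"
    unfolding b using assms(2,3) by (intro prod.mono_neutral_cong_left) auto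
  thus ?thesis
    unfolding power_product_def by (rule exI[of _ "\<lambda>i. if i \<in> S then b i else 0"])
qed

lemma power_product_factor:
  assumes "finite S" "i \<in> S"
  shows "power_product S f (f i)"
proof (rule power_product_mono)
  show "power_product {i} f (f i)"
    unfolding power_product_def by (intro exI[of _ "\<lambda>_. 1"]) simp
qed (use assms in auto)

text \<open>
  For \<open>i\<close> with \<open>z i\<close> minimal, the rows of \<open>i\<close> and \<open>m i\<close> vanish outside the columns \<open>i\<close> and
  \<open>m i\<close>. Splitting off this block, which has size one if \<open>m i\<close> lies outside \<open>S\<close>, leaves a smaller index set with the
  same properties.
\<close>

lemma power_product_det_on_paired:
  fixes z :: "'i \<Rightarrow> nat"
  assumes fin: "finite S"
    and diag: "\<And>i. i \<in> S \<Longrightarrow> M i i = 1"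
    and tri: "\<And>i j. i \<in> S \<Longrightarrow> j \<in> S \<Longrightarrow> j \<noteq> i \<Longrightarrow> j \<noteq> m i \<Longrightarrow> M i j \<noteq> 0 \<Longrightarrow> z j < z i"
    and m: "\<And>i. i \<in> S \<Longrightarrow> m (m i) = i" "\<And>i. i \<in> S \<Longrightarrow> m i \<noteq> i" "\<And>i. i \<in> S \<Longrightarrow> z (m i) = z i"
    and pair: "\<And>i. i \<in> S \<Longrightarrow> m i \<in> S \<Longrightarrow> power_product T f (1 - M i (m i) * M (m i) i)"
  shows "power_product T f (det_on S M)"
  using assms
proof (induction S rule: finite_psubset_induct)
  case (psubset S)
  show ?case
  proof (cases "S = {}")
    case True
    thus ?thesis
      by (simp add: power_product_1)
  next
    case False
    then obtain i where i: "i \<in> S" "\<And>j. j \<in> S \<Longrightarrow> z i \<le> z j"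
      using arg_min_if_finite(1)[OF psubset.hyps] arg_min_least[OF psubset.hyps] by blast
    define A where "A = {i, m i} \<inter> S"
    have zero: "M k j = 0" if k: "k \<in> A" and j: "j \<in> S - A" for k j
    proof (rule ccontr)
      assume "M k j \<noteq> 0"
      moreover have "k \<in> S" "z k = z i" "j \<noteq> k" "j \<noteq> m k"
        using i(1) k j psubset.prems(3,5) by (auto simp: A_def)
      ultimately show False
        using psubset.prems(2)[of k j] i(2)[of j] j by auto
    qed
    have "det_on S M = det_on A M * det_on (S - A) M"
      by (rule det_on_block_triangular[OF psubset.hyps _ zero]) (auto simp: A_def)
    moreover have "power_product T f (det_on A M)"
    proof (cases "m i \<in> S")
      case True
      hence A: "A = {i, m i}"
        using i by (auto simp: A_def)
      have "i \<noteq> m i"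
        using psubset.prems(4)[OF i(1)] by metis
      from det_on_pair[OF this, of M] show ?thesis
        using psubset.prems(1) psubset.prems(6) i True by (simp add: A)
    next
      case False
      hence "A = {i}"
        using i by (auto simp: A_def)
      thus ?thesis
        using psubset.prems(1) i by (simp add: power_product_1)
    qed
    moreover have "power_product T f (det_on (S - A) M)"
    proof (rule psubset.IH)
      show "S - A \<subset> S"
        using i by (auto simp: A_def)
    qed (use psubset.prems in auto)
    ultimately show ?thesis
      by (simp add: power_product_mult)
  qed
qed

section \<open>Sign vectors\<close>

lemma signum_uminus_0 [simp]: "- (0 :: signum) = 0"
  by (simp add: zero_signum_def)

lemma signum_uminus_eq_0_iff [simp]: "- s = 0 \<longleftrightarrow> s = 0" for s :: signum
  by (cases s) (auto simp: zero_signum_def)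

lemma signum_uminus_uminus [simp]: "- (- s) = s" for s :: signum
  by (cases s) auto

lemma signum_eq_uminus_self_iff [simp]: "s = - s \<longleftrightarrow> s = 0" "- s = s \<longleftrightarrow> s = 0" for s :: signum
  by (cases s; simp add: zero_signum_def)+

lemma signum_opposite: "s \<noteq> 0 \<Longrightarrow> t \<noteq> 0 \<Longrightarrow> s \<noteq> t \<Longrightarrow> s = - t" for s t :: signum
  by (cases s; cases t) (auto simp: zero_signum_def)

lemma signum_trichotomy: "s = 0 \<or> s = Pos \<or> s = Neg"
  by (cases s) (auto simp: zero_signum_def)

lemma signum_distinct_0 [simp]: "0 \<noteq> Pos" "0 \<noteq> Neg" "Pos \<noteq> 0" "Neg \<noteq> 0"
  by (simp_all add: zero_signum_def)

lemma le_signvec_iff: "X \<le> Y \<longleftrightarrow> (\<forall>e. X e = 0 \<or> X e = Y e)" for X Y :: "'e signvec"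
  by (simp add: le_fun_def less_eq_signum_def)

lemma comp_sv_apply: "comp_sv X Y e = (if X e \<noteq> 0 then X e else Y e)"
  by (simp add: comp_sv_def)

lemma comp_sv_eq_imp_le: "comp_sv F X = R \<Longrightarrow> F \<le> R"
  unfolding le_signvec_iff by (metis comp_sv_apply)

section \<open>Slices of the covector set and their Euler weights\<close>

text \<open>
  The prescribed values may be zero, so that walls and flats are slices as well as cones.
\<close>

definition slice :: "'e signvec set \<Rightarrow> 'e set \<Rightarrow> 'e signvec \<Rightarrow> 'e signvec set" where
  "slice L A \<sigma> = {F \<in> L. \<forall>a\<in>A. F a = \<sigma> a}"

text \<open>
  On the whole covector set of an oriented matroid of rank \<open>r\<close> this determines \<open>s F\<close> as
  \<open>(-1)\<close> to the power \<open>r - rank F\<close>. The condition replaces a development of the rank function, and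
  it makes sense on every slice.
\<close>

definition euler_weight :: "'e signvec set \<Rightarrow> ('e signvec \<Rightarrow> int) \<Rightarrow> bool" where
  "euler_weight K s \<longleftrightarrow> (\<forall>F\<in>K. (\<Sum>G | G \<in> K \<and> F \<le> G. s G) = 1)"

lemma prod_indicator:
  assumes "finite B"
  shows "(\<Prod>f\<in>B. if P f then 1 else 0 :: 'r::comm_semiring_1) = (if \<forall>f\<in>B. P f then 1 else 0)"
  using assms by (induction B rule: finite_induct) auto

lemma euler_weight_up_closed:
  assumes "euler_weight K s" "K' \<subseteq> K" "\<And>F G. F \<in> K' \<Longrightarrow> G \<in> K \<Longrightarrow> F \<le> G \<Longrightarrow> G \<in> K'"
  shows "euler_weight K' s"
  unfolding euler_weight_def
proof
  fix F assume F: "F \<in> K'"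
  hence "{G. G \<in> K' \<and> F \<le> G} = {G. G \<in> K \<and> F \<le> G}"
    using assms(2,3) by blast
  thus "(\<Sum>G | G \<in> K' \<and> F \<le> G. s G) = 1"
    using assms(1,2) F by (auto simp: euler_weight_def)
qed

text \<open>
  The defining equation at a minimal element \<open>m\<close> can be solved for the value at \<open>m\<close>, which occurs in none of the
  other equations.
\<close>

lemma euler_weight_exists:
  assumes "finite K"
  shows "\<exists>s. euler_weight K s"
  using assms
proof (induction K rule: finite_psubset_induct)
  case (psubset K)
  show ?case
  proof (cases "K = {}")
    case True
    thus ?thesis
      by (simp add: euler_weight_def)
  next
    case False
    then obtain m where m: "m \<in> K" "\<And>x. x \<in> K \<Longrightarrow> x \<le> m \<Longrightarrow> m = x"
      using finite_has_minimal[OF psubset.hyps] by blast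
    obtain s where s: "euler_weight (K - {m}) s"
      using psubset.IH[of "K - {m}"] m by blast
    define s' where "s' = s(m := 1 - (\<Sum>G | G \<in> K - {m} \<and> m \<le> G. s G))"
    have "(\<Sum>G | G \<in> K \<and> F \<le> G. s' G) = 1" if F: "F \<in> K" for F
    proof (cases "F = m")
      case True
      have "{G. G \<in> K \<and> m \<le> G} = insert m {G. G \<in> K - {m} \<and> m \<le> G}"
        using m by auto
      moreover have "(\<Sum>G | G \<in> K - {m} \<and> m \<le> G. s' G) = (\<Sum>G | G \<in> K - {m} \<and> m \<le> G. s G)"
        by (rule sum.cong) (auto simp: s'_def)
      ultimately show ?thesis
        using psubset.hyps by (simp add: True) (simp add: s'_def)
    next
      case False
      have "(\<Sum>G | G \<in> K \<and> F \<le> G. s' G) = (\<Sum>G | G \<in> K - {m} \<and> F \<le> G. s G)"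
        using m(2)[OF F] False by (intro sum.cong) (auto simp: s'_def)
      thus ?thesis
        using s F False by (simp add: euler_weight_def)
    qed
    thus ?thesis
      unfolding euler_weight_def by blast
  qed
qed

context oriented_matroid
begin

lemma finite_covectors: "finite L"
proof (rule finite_subset)
  show "L \<subseteq> {F. \<forall>e. (e \<in> E \<longrightarrow> F e \<in> UNIV) \<and> (e \<notin> E \<longrightarrow> F e = 0)}"
    using covector_outside by auto
  have "UNIV = {Zero, Pos, Neg}"
    using signum.exhaust by auto
  hence "finite (UNIV :: signum set)"
    by (metis finite.simps)
  thus "finite {F. \<forall>e. (e \<in> E \<longrightarrow> F e \<in> (UNIV :: signum set)) \<and> (e \<notin> E \<longrightarrow> F e = 0)}"
    using finite_ground by (intro finite_set_of_finite_funs)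
qed

lemma finite_slice: "finite (slice L A \<sigma>)"
  using finite_covectors by (simp add: slice_def)

lemma slice_comp:
  assumes "X \<in> slice L A \<sigma>" "Y \<in> slice L A \<sigma>"
  shows "comp_sv X Y \<in> slice L A \<sigma>"
  using assms by (auto simp: slice_def covector_comp comp_sv_apply)

lemma slice_comp_uminus:
  assumes "X \<in> slice L A \<sigma>" "Y \<in> slice L A \<sigma>"
  shows "comp_sv X (- Y) \<in> slice L A \<sigma>"
  using assms by (auto simp: slice_def covector_comp covector_uminus comp_sv_apply)

text \<open>
  If \<open>Y e = 0\<close>, the composition of \<open>Y\<close> with \<open>-X\<close> has the sign opposite to \<open>X\<close> at \<open>e\<close>. It stays in the slice, since
  the prescribed zeros are common zeros of \<open>X\<close> and \<open>Y\<close>.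
\<close>

lemma slice_two_signs:
  assumes X: "X \<in> slice L A \<sigma>" "X e \<noteq> 0" and Y: "Y \<in> slice L A \<sigma>" "Y e \<noteq> X e"
    and t: "t \<noteq> 0"
  obtains Z where "Z \<in> slice L A \<sigma>" "Z e = t"
proof -
  have "\<exists>W\<in>slice L A \<sigma>. W e = - X e"
  proof (cases "Y e = 0")
    case True
    thus ?thesis
      using slice_comp_uminus[OF Y(1) X(1)]
      by (intro bexI[of _ "comp_sv Y (- X)"]) (simp_all add: comp_sv_apply)
  next
    case False
    thus ?thesis
      using Y X signum_opposite by metis
  qed
  thus ?thesis
    using X t that signum_opposite[of t "X e"] by metis
qed

text \<open>
  This is the elimination axiom: two members of a slice are never separated by an element at which
  the slice prescribes a value.
\<close>

lemma slice_wall: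
  assumes X: "X \<in> slice L A \<sigma>" "X e \<noteq> 0" and Y: "Y \<in> slice L A \<sigma>" "Y e \<noteq> X e"
  obtains Z where "Z \<in> slice L A \<sigma>" "Z e = 0"
proof -
  obtain W where W: "W \<in> slice L A \<sigma>" "W e = - X e"
    using slice_two_signs[OF X Y, of "- X e"] X(2) by auto
  have XW: "X \<in> L" "W \<in> L" "\<And>a. a \<in> A \<Longrightarrow> X a = \<sigma> a" "\<And>a. a \<in> A \<Longrightarrow> W a = \<sigma> a"
    using X W by (auto simp: slice_def)
  have "e \<in> Sep E X W"
    using X W XW(1) covector_outside[of X e] by (auto simp: Sep_def)
  then obtain Z where Z: "Z \<in> L" "Z e = 0" "\<forall>f\<in>E - Sep E X W. Z f = comp_sv X W f"
    using covector_elim[OF XW(1,2)] by blast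
  have "Z a = \<sigma> a" if a: "a \<in> A" for a
  proof (cases "a \<in> E")
    case True
    hence "a \<in> E - Sep E X W"
      using XW(3,4)[OF a] by (auto simp: Sep_def)
    thus ?thesis
      using Z XW(3,4)[OF a] by (auto simp: comp_sv_apply)
  next
    case False
    thus ?thesis
      using XW(1) Z(1) XW(3)[OF a] covector_outside by metis
  qed
  with Z that show ?thesis
    by (auto simp: slice_def)
qed

text \<open>
  Prescribing further nonzero values cuts out a part of the slice that is closed upwards.
\<close>

lemma euler_weight_upper:
  assumes "euler_weight (slice L A \<sigma>) s"
    and t: "\<And>a. a \<in> A \<Longrightarrow> t a = \<sigma> a" "\<And>b. b \<in> B \<Longrightarrow> t b \<noteq> 0"
  shows "euler_weight (slice L (A \<union> B) t) s"
proof (rule euler_weight_up_closed[OF assms(1)])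
  fix F G assume F: "F \<in> slice L (A \<union> B) t" and G: "G \<in> slice L A \<sigma>" and FG: "F \<le> G"
  have "G b = t b" if "b \<in> B" for b
    using F t(2) FG that by (metis (mono_tags, lifting) UnI2 le_signvec_iff mem_Collect_eq slice_def)
  thus "G \<in> slice L (A \<union> B) t"
    using G t(1) by (auto simp: slice_def)
qed (use t in \<open>auto simp: slice_def\<close>)

text \<open>
  The covectors above a member \<open>F\<close> of the wall have total weight \<open>1\<close>. Those on either side of
  the wall form a slice, in which the signs of \<open>F\<close> and the sign at \<open>e\<close> are prescribed, and contribute \<open>1\<close>
  each; so those in the wall contribute \<open>-1\<close>. The last assumption is that such slices have total weight \<open>1\<close>:
  in this form the lemma can serve in the induction that proves just this for all slices.
\<close>

lemma euler_weight_wall_if: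
  assumes w: "euler_weight (slice L A \<sigma>) s"
    and signs: "\<And>t. t \<noteq> 0 \<Longrightarrow> \<exists>Z\<in>slice L A \<sigma>. Z e = t"
    and one: "\<And>B t. e \<in> B \<Longrightarrow> slice L (A \<union> B) t \<noteq> {} \<Longrightarrow> euler_weight (slice L (A \<union> B) t) s
      \<Longrightarrow> sum s (slice L (A \<union> B) t) = 1"
  shows "euler_weight {F \<in> slice L A \<sigma>. F e = 0} (\<lambda>F. - s F)"
  unfolding euler_weight_def
proof
  fix F assume F: "F \<in> {F \<in> slice L A \<sigma>. F e = 0}"
  let ?K = "slice L A \<sigma>"
  let ?S = "\<lambda>x. {G. G \<in> ?K \<and> F \<le> G \<and> G e = x}"
  have FK: "F \<in> ?K" "F e = 0"
    using F by auto
  have half: "sum s (?S t) = 1" if t: "t \<noteq> 0" for t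
  proof -
    let ?B = "insert e {f. F f \<noteq> 0}"
    have eA: "\<sigma> e = t" if "e \<in> A"
      using signs[OF t] that by (auto simp: slice_def)
    have Fe: "(F(e := t)) a = \<sigma> a" if "a \<in> A" for a
      using FK that eA by (auto simp: slice_def)
    have eq: "slice L (A \<union> ?B) (F(e := t)) = ?S t"
    proof (intro equalityI subsetI)
      fix G assume "G \<in> slice L (A \<union> ?B) (F(e := t))"
      hence G: "G \<in> L" "\<And>f. f \<in> A \<union> ?B \<Longrightarrow> G f = (F(e := t)) f"
        by (auto simp: slice_def)
      have "G a = \<sigma> a" if "a \<in> A" for a
        using G(2)[of a] Fe that by simp
      moreover have "F f = 0 \<or> F f = G f" for f
        using G(2)[of f] FK(2) by (cases "f = e"; cases "F f = 0") auto
      moreover have "G e = t"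
        using G(2)[of e] by simp
      ultimately show "G \<in> ?S t"
        using G(1) by (simp add: slice_def le_signvec_iff)
    next
      fix G assume "G \<in> ?S t"
      hence G: "G \<in> L" "\<And>a. a \<in> A \<Longrightarrow> G a = \<sigma> a" "\<And>f. F f = 0 \<or> F f = G f" "G e = t"
        by (auto simp: slice_def le_signvec_iff)
      have "G f = (F(e := t)) f" if "f \<in> A \<union> ?B" for f
        using that G(2)[of f] G(3)[of f] G(4) Fe[of f] by (cases "f = e") auto
      thus "G \<in> slice L (A \<union> ?B) (F(e := t))"
        using G(1) by (simp add: slice_def)
    qed
    obtain Z where Z: "Z \<in> ?K" "Z e = t"
      using signs[OF t] by blast
    \<comment> \<open>A member of the slice above \<open>F\<close> on the required side: \<open>F\<close> leaves its zero at \<open>e\<close> to \<open>Z\<close>.\<close>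
    have "comp_sv F Z \<in> ?S t"
      using slice_comp[OF FK(1) Z(1)] Z FK by (auto simp: le_signvec_iff comp_sv_apply)
    hence "slice L (A \<union> ?B) (F(e := t)) \<noteq> {}"
      unfolding eq by blast
    moreover have "euler_weight (slice L (A \<union> ?B) (F(e := t))) s"
      by (rule euler_weight_upper[OF w Fe]) (use t in auto)
    ultimately show ?thesis
      using one[of ?B "F(e := t)"] unfolding eq by simp
  qed
  have fin: "finite (?S x)" for x
    using finite_slice by simp
  have "{G. G \<in> ?K \<and> F \<le> G} = ?S 0 \<union> (?S Pos \<union> ?S Neg)"
    using signum_trichotomy by auto
  moreover have "(\<Sum>G | G \<in> ?K \<and> F \<le> G. s G) = 1"
    using w FK(1) unfolding euler_weight_def by blast
  ultimately have "1 = sum s (?S 0 \<union> (?S Pos \<union> ?S Neg))"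
    by (simp only:)
  also have "\<dots> = sum s (?S 0) + (sum s (?S Pos) + sum s (?S Neg))"
    using fin by (subst sum.union_disjoint; (subst sum.union_disjoint)?)
      auto
  also have "\<dots> = sum s (?S 0) + 2"
    using half by simp
  finally have "sum s (?S 0) = - 1"
    by simp
  moreover have "{G. G \<in> {F \<in> ?K. F e = 0} \<and> F \<le> G} = ?S 0"
    by auto
  ultimately show "(\<Sum>G | G \<in> {F \<in> ?K. F e = 0} \<and> F \<le> G. - s G) = 1"
    by (simp add: sum_negf)
qed

text \<open>
  If two members of the slice differ at \<open>e\<close>, then the slice meets both sides of the wall of \<open>e\<close> and the
  wall itself. By induction each side has weight \<open>1\<close>, and so has the wall with respect to the weight
  \<open>-s\<close>; and \<open>1 + 1 - 1 = 1\<close>.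
\<close>

lemma euler_weight_sum:
  assumes "euler_weight (slice L A \<sigma>) s" "slice L A \<sigma> \<noteq> {}"
  shows "sum s (slice L A \<sigma>) = 1"
  using assms
proof (induction "card (E - A)" arbitrary: A \<sigma> s rule: less_induct)
  case less
  let ?K = "slice L A \<sigma>"
  have IH: "sum s' (slice L (A \<union> B) t) = 1"
    if "e \<in> B" "e \<in> E" "e \<notin> A" "slice L (A \<union> B) t \<noteq> {}" "euler_weight (slice L (A \<union> B) t) s'"
    for e B t s'
    using that finite_ground by (intro less.hyps psubset_card_mono) blast+
  show ?case
  proof (cases "\<exists>X\<in>?K. \<exists>Y\<in>?K. X \<noteq> Y")
    case False
    then obtain F where F: "?K = {F}"
      using less.prems(2) by blast
    hence "{G. G \<in> ?K \<and> F \<le> G} = {F}"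
      by auto
    thus ?thesis
      using less.prems(1) unfolding euler_weight_def F by simp
  next
    case True
    then obtain X Y e where XY: "X \<in> ?K" "Y \<in> ?K" "X e \<noteq> 0" "Y e \<noteq> X e"
      by (metis ext)
    have e: "e \<in> E" "e \<notin> A"
      using XY covector_outside by (auto simp: slice_def)
    have signs: "\<exists>Z\<in>?K. Z e = t" for t
      using slice_two_signs[OF XY(1,3,2,4), of t] slice_wall[OF XY(1,3,2,4)] by metis
    have cell: "{F \<in> ?K. F e = t} = slice L (A \<union> {e}) (\<sigma>(e := t))" for t
      using e by (auto simp: slice_def)
    have ne: "slice L (A \<union> {e}) (\<sigma>(e := t)) \<noteq> {}" for t
      using signs[of t] unfolding cell[symmetric] by blast
    have "euler_weight {F \<in> ?K. F e = 0} (\<lambda>F. - s F)"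
      by (rule euler_weight_wall_if[OF less.prems(1)]) (use IH e signs in auto)
    hence "(\<Sum>F | F \<in> ?K \<and> F e = 0. - s F) = 1"
      using IH[of e "{e}", OF _ e ne] by (simp add: cell)
    moreover have "(\<Sum>F | F \<in> ?K \<and> F e = t. s F) = 1" if "t \<noteq> 0" for t
    proof -
      have "euler_weight (slice L (A \<union> {e}) (\<sigma>(e := t))) s"
        by (rule euler_weight_upper[OF less.prems(1)]) (use e that in auto)
      thus ?thesis
        using IH[of e "{e}", OF _ e ne] by (simp add: cell)
    qed
    moreover have "sum s ?K = (\<Sum>F | F \<in> ?K \<and> F e = 0. s F)
        + ((\<Sum>F | F \<in> ?K \<and> F e = Pos. s F) + (\<Sum>F | F \<in> ?K \<and> F e = Neg. s F))"
    proof -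
      have "?K = {F. F \<in> ?K \<and> F e = 0} \<union> ({F. F \<in> ?K \<and> F e = Pos} \<union> {F. F \<in> ?K \<and> F e = Neg})"
        using signum_trichotomy by auto
      thus ?thesis
        using finite_slice[of A \<sigma>]
        by (subst sum.union_disjoint[symmetric]; (subst sum.union_disjoint[symmetric])?)
          auto
    qed
    ultimately show ?thesis
      by (simp add: sum_negf)
  qed
qed

lemma euler_weight_wall:
  assumes w: "euler_weight (slice L A \<sigma>) s"
    and X: "X \<in> slice L A \<sigma>" "X e \<noteq> 0" and Y: "Y \<in> slice L A \<sigma>" "Y e \<noteq> X e"
  shows "euler_weight {F \<in> slice L A \<sigma>. F e = 0} (\<lambda>F. - s F)"
proof (rule euler_weight_wall_if[OF w])
  fix t :: signum assume "t \<noteq> 0"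
  thus "\<exists>Z\<in>slice L A \<sigma>. Z e = t"
    using slice_two_signs[OF X Y] by blast
qed (rule euler_weight_sum)

text \<open>
  Each element of \<open>Z\<close> either vanishes already on the current flat or defines a wall in it, and then
  the sign of the weight changes.
\<close>

lemma euler_weight_flat:
  assumes w: "euler_weight L s" and Z: "Z \<subseteq> E"
  obtains c :: int where "c * c = 1" "euler_weight (slice L Z (\<lambda>_. 0)) (\<lambda>F. c * s F)"
proof -
  have "finite Z"
    using Z finite_ground finite_subset by blast
  hence "\<exists>c :: int. c * c = 1 \<and> euler_weight (slice L Z (\<lambda>_. 0)) (\<lambda>F. c * s F)"
  proof (induction Z rule: finite_induct)
    case empty
    thus ?case
      using w by (intro exI[of _ 1]) (simp add: slice_def)
  next
    case (insert e Z)
    then obtain c :: int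
      where c: "c * c = 1" "euler_weight (slice L Z (\<lambda>_. 0)) (\<lambda>F. c * s F)"
      by blast
    let ?K = "slice L Z (\<lambda>_. 0)"
    have K': "slice L (insert e Z) (\<lambda>_. 0) = {F \<in> ?K. F e = 0}"
      by (auto simp: slice_def)
    show ?case
    proof (cases "\<exists>X\<in>?K. X e \<noteq> 0")
      case True
      then obtain X where X: "X \<in> ?K" "X e \<noteq> 0"
        by blast
      have "(\<lambda>_. 0) \<in> ?K"
        using covector_zero by (simp add: slice_def)
      hence "euler_weight (slice L (insert e Z) (\<lambda>_. 0)) (\<lambda>F. - (c * s F))"
        unfolding K' using X by (intro euler_weight_wall[OF c(2) X]) auto
      thus ?thesis
        using c(1) by (intro exI[of _ "- c"]) simp
    next
      case False
      hence "slice L (insert e Z) (\<lambda>_. 0) = ?K"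
        unfolding K' by blast
      thus ?thesis
        using c by metis
    qed
  qed
  thus ?thesis
    using that by blast
qed

text \<open>
  At one element \<open>b\<close> of \<open>B\<close>, the factor is \<open>w b\<close> plus, if \<open>F b = Q b\<close>, the difference \<open>u b - w b\<close>. The remaining sum
  has the same value over the slice and over its part with \<open>F b = Q b\<close>, which is again a slice
  containing \<open>P\<close>; so \<open>b\<close> contributes \<open>w b + (u b - w b) = u b\<close>.
\<close>

lemma euler_weight_mixed_sum:
  fixes u w :: "'e \<Rightarrow> 'r::comm_ring_1"
  assumes s: "euler_weight (slice L A \<sigma>) s"
    and P: "P \<in> slice L A \<sigma>" "\<And>f. f \<in> B \<Longrightarrow> P f = Q f"
    and Q: "\<And>f. f \<in> B \<Longrightarrow> Q f \<noteq> 0"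
    and fin: "finite B"
  shows "(\<Sum>F\<in>slice L A \<sigma>. of_int (s F) * (\<Prod>f\<in>B. if F f = Q f then u f else w f)) = prod u B"
  using fin s P Q
proof (induction B arbitrary: A \<sigma> rule: finite_induct)
  case empty
  have "sum s (slice L A \<sigma>) = 1"
    using empty(2) by (intro euler_weight_sum[OF empty(1)]) blast
  moreover have "(\<Sum>F\<in>slice L A \<sigma>. of_int (s F) * (\<Prod>f\<in>{}. if F f = Q f then u f else w f))
      = (of_int (sum s (slice L A \<sigma>)) :: 'r)"
    by simp
  ultimately show ?case
    by simp
next
  case (insert b B)
  let ?K = "slice L A \<sigma>"
  define \<tau> where "\<tau> = \<sigma>(b := Q b)"
  let ?K' = "slice L (A \<union> {b}) \<tau>"
  let ?p = "\<lambda>F. of_int (s F) * (\<Prod>f\<in>B. if F f = Q f then u f else w f)"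
  have \<tau>A: "\<tau> a = \<sigma> a" if "a \<in> A" for a
    using insert.prems(2) insert.prems(3)[of b] that by (auto simp: \<tau>_def slice_def)
  have \<tau>b: "\<tau> b = Q b"
    by (simp add: \<tau>_def)
  have K': "?K' = {F \<in> ?K. F b = Q b}"
    by (auto simp: slice_def \<tau>A \<tau>b)
  have s': "euler_weight ?K' s"
    by (rule euler_weight_upper[OF insert.prems(1) \<tau>A]) (use insert.prems(4)[of b] \<tau>b in auto)
  have "P \<in> ?K'"
    unfolding K' using insert.prems(2) insert.prems(3)[of b] by simp
  hence K'_sum: "sum ?p ?K' = prod u B"
    by (rule insert.IH[OF s']) (use insert.prems(3,4) in blast)+
  have K_sum: "sum ?p ?K = prod u B"
    by (rule insert.IH[OF insert.prems(1,2)]) (use insert.prems(3,4) in blast)+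
  have "(\<Sum>F\<in>?K. of_int (s F) * (\<Prod>f\<in>insert b B. if F f = Q f then u f else w f))
      = (\<Sum>F\<in>?K. w b * ?p F + (if F b = Q b then (u b - w b) * ?p F else 0))"
  proof (rule sum.cong[OF refl])
    fix F
    let ?r = "\<Prod>f\<in>B. if F f = Q f then u f else w f"
    have "(\<Prod>f\<in>insert b B. if F f = Q f then u f else w f) = (if F b = Q b then u b else w b) * ?r"
      by (rule prod.insert[OF insert.hyps])
    thus "of_int (s F) * (\<Prod>f\<in>insert b B. if F f = Q f then u f else w f)
        = w b * (of_int (s F) * ?r) + (if F b = Q b then (u b - w b) * (of_int (s F) * ?r) else 0)"
      by (simp add: algebra_simps)
  qed
  also have "\<dots> = w b * sum ?p ?K + (u b - w b) * sum ?p ?K'"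
    unfolding sum.distrib sum_distrib_left K'
    using sum.inter_filter[OF finite_slice[of A \<sigma>], of "\<lambda>F. (u b - w b) * ?p F" "\<lambda>F. F b = Q b"]
    by simp
  also have "\<dots> = prod u (insert b B)"
    unfolding K_sum K'_sum prod.insert[OF insert.hyps] by (simp add: algebra_simps)
  finally show ?case .
qed

text \<open>
  The condition on \<open>F\<close> says, element by element, whether or not \<open>F\<close> agrees with \<open>H\<close>. Its indicator
  is therefore a product as in \<open>euler_weight_mixed_sum\<close>, whose value there is \<open>0\<close> as soon as \<open>G\<close> and \<open>H\<close>
  disagree somewhere.
\<close>

lemma euler_weight_fibre:
  assumes s: "euler_weight (slice L A \<sigma>) s"
    and H: "H \<in> slice L A \<sigma>"
    and supp: "\<And>f. G f = 0 \<longleftrightarrow> H f = 0" "\<And>F f. F \<in> slice L A \<sigma> \<Longrightarrow> H f = 0 \<Longrightarrow> F f = 0"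
  shows "(\<Sum>F | F \<in> slice L A \<sigma> \<and> comp_sv F (- H) = G. s F) = (if G = H then 1 else 0)"
proof -
  let ?K = "slice L A \<sigma>"
  let ?B = "{f. H f \<noteq> 0}"
  have fin: "finite ?B"
    using H finite_ground covector_outside by (auto simp: slice_def intro: finite_subset)
  have fibre_iff: "comp_sv F (- H) = G \<longleftrightarrow> (\<forall>f\<in>?B. F f = H f \<longleftrightarrow> G f = H f)" if F: "F \<in> ?K" for F
  proof -
    have "comp_sv F (- H) f = G f \<longleftrightarrow> (H f \<noteq> 0 \<longrightarrow> (F f = H f \<longleftrightarrow> G f = H f))" for f
      using supp(1)[of f] supp(2)[OF F, of f]
        signum_opposite[of "G f" "H f"] signum_opposite[of "F f" "H f"]
      by (cases "H f = 0"; cases "F f = 0") (auto simp: comp_sv_apply)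
    thus ?thesis
      by (auto simp: fun_eq_iff)
  qed
  have "(\<Sum>F | F \<in> ?K \<and> comp_sv F (- H) = G. s F)
      = (\<Sum>F\<in>?K. of_int (s F) * (\<Prod>f\<in>?B. if F f = H f \<longleftrightarrow> G f = H f then 1 else 0))"
    using sum.inter_filter[OF finite_slice[of A \<sigma>], of s "\<lambda>F. comp_sv F (- H) = G"] fin
    by (simp add: prod_indicator fibre_iff if_distrib cong: sum.cong if_cong)
  also have "\<dots> = (\<Sum>F\<in>?K. of_int (s F) *
      (\<Prod>f\<in>?B. if F f = H f then if G f = H f then 1 else 0 else if G f \<noteq> H f then 1 else 0))"
    by (intro sum.cong refl arg_cong[where f="\<lambda>x. _ * x"] prod.cong) auto
  also have "\<dots> = (\<Prod>f\<in>?B. if G f = H f then 1 else 0)"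
    by (rule euler_weight_mixed_sum[OF s H _ _ fin]) auto
  also have "\<dots> = (if G = H then 1 else 0)"
  proof -
    have "G f = H f" if "\<forall>f\<in>?B. G f = H f" for f
      using that supp(1)[of f] by (cases "H f = 0") auto
    hence "(\<forall>f\<in>?B. G f = H f) \<longleftrightarrow> G = H"
      by (auto simp: fun_eq_iff)
    thus ?thesis
      by (simp only: prod_indicator[OF fin])
  qed
  finally show ?thesis .
qed

end

section \<open>Wall faces and mirror images of topes\<close>

definition wall_face :: "'e signvec set \<Rightarrow> 'e \<Rightarrow> 'e signvec \<Rightarrow> 'e signvec" where
  "wall_face L e R = (THE G. G \<in> L \<and> G \<le> R \<and> G e = 0 \<and> (\<forall>F\<in>L. F \<le> R \<longrightarrow> F e = 0 \<longrightarrow> F \<le> G))"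

text \<open>
  The tope obtained from \<open>R\<close> by reversing the signs at the zeros of its wall face.
\<close>

definition mirror :: "'e signvec set \<Rightarrow> 'e \<Rightarrow> 'e signvec \<Rightarrow> 'e signvec" where
  "mirror L e R = comp_sv (wall_face L e R) (- R)"

text \<open>
  The part of the sum in \<open>euler_weight_fibre\<close> that comes from the wall of \<open>e\<close>.
\<close>

definition wall_coeff :: "'e signvec set \<Rightarrow> ('e signvec \<Rightarrow> int) \<Rightarrow> 'e \<Rightarrow> 'e signvec \<Rightarrow> 'e signvec \<Rightarrow> int" where
  "wall_coeff L s e Q R = (\<Sum>F | F \<in> L \<and> F e = 0 \<and> comp_sv F (- Q) = R. s F)"

context oriented_matroid
begin

lemma tope_covector: "T \<in> topes L \<Longrightarrow> T \<in> L"
  by (simp add: topes_def)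

lemma tope_nonzero:
  assumes "loopless E L" "T \<in> topes L" "e \<in> E"
  shows "T e \<noteq> 0"
proof
  assume Te: "T e = 0"
  obtain X where X: "X \<in> L" "X e \<noteq> 0"
    using assms(1,3) by (auto simp: loopless_def)
  have "T \<le> comp_sv T X"
    by (rule comp_sv_eq_imp_le) (rule refl)
  hence "comp_sv T X = T"
    using assms(2) X(1) covector_comp by (auto simp: topes_def)
  thus False
    using Te X(2) by (metis comp_sv_apply)
qed

lemma topeI:
  assumes "T \<in> L" "\<And>e. e \<in> E \<Longrightarrow> T e \<noteq> 0"
  shows "T \<in> topes L"
proof -
  have "X = T" if X: "X \<in> L" "T \<le> X" for X
  proof
    fix e
    show "X e = T e"
      using X(2) assms(2)[of e] covector_outside[OF assms(1), of e] covector_outside[OF X(1), of e]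
      unfolding le_signvec_iff by metis
  qed
  thus ?thesis
    using assms(1) by (simp add: topes_def)
qed

lemma comp_uminus_tope:
  assumes "loopless E L" "F \<in> L" "Q \<in> topes L"
  shows "comp_sv F (- Q) \<in> topes L"
  using tope_nonzero[OF assms(1,3)] assms(2) tope_covector[OF assms(3)]
  by (intro topeI covector_comp covector_uminus) (auto simp: comp_sv_apply)

text \<open>
  The composition of two faces of \<open>R\<close> in the wall is again one, so a maximal such face is the
  greatest.
\<close>

lemma wall_face_exists:
  "\<exists>G. G \<in> L \<and> G \<le> R \<and> G e = 0 \<and> (\<forall>F\<in>L. F \<le> R \<longrightarrow> F e = 0 \<longrightarrow> F \<le> G)"
proof -
  let ?W = "{F \<in> L. F \<le> R \<and> F e = 0}"
  have fin: "finite ?W"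
    using finite_covectors by simp
  have "(\<lambda>_. 0) \<in> ?W"
    using covector_zero by (simp add: le_signvec_iff)
  hence ne: "?W \<noteq> {}"
    by (metis empty_iff)
  obtain G where G: "G \<in> ?W" "\<And>F. F \<in> ?W \<Longrightarrow> G \<le> F \<Longrightarrow> G = F"
  proof -
    from finite_has_maximal[OF fin ne] obtain G where "G \<in> ?W" "\<forall>F\<in>?W. G \<le> F \<longrightarrow> G = F"
      by (elim bexE)
    thus ?thesis
      using that by blast
  qed
  have "F \<le> G" if F: "F \<in> ?W" for F
  proof -
    have le: "F f = 0 \<or> F f = R f" "G f = 0 \<or> G f = R f" for f
      using F G(1) unfolding le_signvec_iff by blast+
    have "comp_sv G F \<le> R"
      using le unfolding le_signvec_iff comp_sv_apply by metis
    hence "comp_sv G F \<in> ?W"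
      using F G(1) covector_comp by (simp add: comp_sv_apply)
    moreover have "G \<le> comp_sv G F"
      by (rule comp_sv_eq_imp_le) (rule refl)
    ultimately have "G = comp_sv G F"
      by (rule G(2))
    hence "G f = comp_sv G F f" for f
      by metis
    thus ?thesis
      using le by (metis comp_sv_apply le_signvec_iff)
  qed
  thus ?thesis
    using G(1) by blast
qed

lemma wall_face:
  shows wall_face_covector: "wall_face L e R \<in> L"
    and wall_face_le: "wall_face L e R \<le> R"
    and wall_face_zero: "wall_face L e R e = 0"
    and wall_face_greatest: "F \<in> L \<Longrightarrow> F \<le> R \<Longrightarrow> F e = 0 \<Longrightarrow> F \<le> wall_face L e R"
proof -
  let ?P = "\<lambda>G. G \<in> L \<and> G \<le> R \<and> G e = 0 \<and> (\<forall>F\<in>L. F \<le> R \<longrightarrow> F e = 0 \<longrightarrow> F \<le> G)"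
  have "\<exists>!G. ?P G"
    using wall_face_exists[of R e] by (blast intro: antisym)
  hence "?P (wall_face L e R)"
    unfolding wall_face_def by (rule theI')
  thus "wall_face L e R \<in> L" "wall_face L e R \<le> R" "wall_face L e R e = 0"
    "F \<in> L \<Longrightarrow> F \<le> R \<Longrightarrow> F e = 0 \<Longrightarrow> F \<le> wall_face L e R"
    by blast+
qed

text \<open>
  Let \<open>G\<close> and \<open>G'\<close> be the wall faces of \<open>R\<close> and of its mirror image. Reflecting \<open>G'\<close> in \<open>G\<close> gives a
  face of \<open>R\<close> in the wall, which by maximality has no more support than \<open>G\<close>.
\<close>

lemma wall_face_mirror: "wall_face L e (mirror L e R) = wall_face L e R"
proof (rule antisym)
  let ?G = "wall_face L e R" and ?G' = "wall_face L e (mirror L e R)"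
  have G: "?G f = 0 \<or> ?G f = R f" for f
    using wall_face_le[of e R] unfolding le_signvec_iff by blast
  have G': "?G' f = 0 \<or> ?G' f = mirror L e R f" for f
    using wall_face_le[of e "mirror L e R"] unfolding le_signvec_iff by blast
  show "?G \<le> ?G'"
    by (intro wall_face_greatest wall_face_covector wall_face_zero comp_sv_eq_imp_le[OF mirror_def[symmetric]])
  have "comp_sv ?G (- ?G') \<le> R"
    unfolding le_signvec_iff
  proof
    fix f
    show "comp_sv ?G (- ?G') f = 0 \<or> comp_sv ?G (- ?G') f = R f"
      using G[of f] G'[of f] by (cases "?G f = 0") (auto simp: comp_sv_apply mirror_def)
  qed
  hence "comp_sv ?G (- ?G') \<le> ?G"
    by (intro wall_face_greatest covector_comp covector_uminus wall_face_covector)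
      (simp_all add: comp_sv_apply wall_face_zero)
  hence zero: "?G' f = 0" if "?G f = 0" for f
    using that unfolding le_signvec_iff by (metis comp_sv_apply fun_Compl_def signum_uminus_eq_0_iff)
  show "?G' \<le> ?G"
    unfolding le_signvec_iff
  proof
    fix f
    show "?G' f = 0 \<or> ?G' f = ?G f"
      using G'[of f] zero[of f] by (cases "?G f = 0") (auto simp: comp_sv_apply mirror_def)
  qed
qed

lemma mirror_mirror: "mirror L e (mirror L e R) = R"
proof (rule ext)
  fix f
  have "wall_face L e R f = 0 \<or> wall_face L e R f = R f"
    using wall_face_le[of e R] unfolding le_signvec_iff by blast
  thus "mirror L e (mirror L e R) f = R f"
    unfolding mirror_def[of L e "mirror L e R"] wall_face_mirror
    by (auto simp: mirror_def comp_sv_apply)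
qed

lemma off_wall_coeff:
  assumes "loopless E L" "euler_weight L s" "Q \<in> topes L" "R \<in> topes L"
  shows "(\<Sum>F | F \<in> L \<and> F e \<noteq> 0 \<and> comp_sv F (- Q) = R. s F)
    = (if R = Q then 1 else 0) - wall_coeff L s e Q R"
proof -
  have L: "slice L {} (\<lambda>_. 0) = L"
    by (simp add: slice_def)
  have zero_iff: "T f = 0 \<longleftrightarrow> f \<notin> E" if "T \<in> topes L" for T f
    using tope_nonzero[OF assms(1) that] covector_outside[OF tope_covector[OF that]] by blast
  have "(\<Sum>F | F \<in> slice L {} (\<lambda>_. 0) \<and> comp_sv F (- Q) = R. s F) = (if R = Q then 1 else 0)"
  proof (rule euler_weight_fibre)
    show "R f = 0 \<longleftrightarrow> Q f = 0" for f
      using assms(3,4) by (simp add: zero_iff)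
    show "F f = 0" if "F \<in> slice L {} (\<lambda>_. 0)" "Q f = 0" for F f
      using that assms(3) covector_outside by (simp add: zero_iff L)
  qed (use assms tope_covector in \<open>auto simp: L\<close>)
  hence "(\<Sum>F | F \<in> L \<and> comp_sv F (- Q) = R. s F) = (if R = Q then 1 else 0)"
    by (simp add: L)
  moreover have "(\<Sum>F | F \<in> L \<and> comp_sv F (- Q) = R. s F)
      = wall_coeff L s e Q R + (\<Sum>F | F \<in> L \<and> F e \<noteq> 0 \<and> comp_sv F (- Q) = R. s F)"
    unfolding wall_coeff_def using finite_covectors
    by (subst sum.union_disjoint[symmetric]) (auto intro!: sum.cong)
  ultimately show ?thesis
    by simp
qed

text \<open>
  Every \<open>F\<close> that contributes to the wall coefficient lies below the wall face of \<open>R\<close>, and at a zero of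
  \<open>F\<close> the composition takes its sign from \<open>-Q\<close>.
\<close>

lemma fibre_zero:
  assumes "F \<in> L" "F e = 0" "comp_sv F (- Q) = R" "wall_face L e R f = 0"
  shows "R f = - Q f"
proof -
  have "F \<le> wall_face L e R"
    using assms(1,2) comp_sv_eq_imp_le[OF assms(3)] by (intro wall_face_greatest)
  hence "F f = 0"
    using assms(4) unfolding le_signvec_iff by metis
  thus ?thesis
    using fun_cong[OF assms(3), of f] by (simp add: comp_sv_apply)
qed

text \<open>
  Let \<open>H\<close> and \<open>G\<close> be the wall faces of \<open>Q\<close> and \<open>R\<close>. At the zeros of \<open>G\<close> the tope \<open>R\<close> is opposite to \<open>Q\<close>,
  so the composition of \<open>G\<close> with \<open>-H\<close> is a face of \<open>R\<close> in the wall. As \<open>G\<close> is the greatest such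
  face, \<open>H\<close> has no support outside that of \<open>G\<close>.
\<close>

lemma wall_coeff_zeros:
  assumes "wall_coeff L s e Q R \<noteq> 0" "wall_face L e R f = 0"
  shows "wall_face L e Q f = 0"
proof -
  let ?H = "wall_face L e Q" and ?G = "wall_face L e R"
  have "{F. F \<in> L \<and> F e = 0 \<and> comp_sv F (- Q) = R} \<noteq> {}"
    using assms(1) unfolding wall_coeff_def by (metis sum.empty)
  then obtain F where F: "F \<in> L" "F e = 0" "comp_sv F (- Q) = R"
    by blast
  have "comp_sv ?G (- ?H) \<le> R"
    unfolding le_signvec_iff
  proof
    fix g
    have "?G g = 0 \<or> ?G g = R g" "?H g = 0 \<or> ?H g = Q g"
      using wall_face_le[of e R] wall_face_le[of e Q] unfolding le_signvec_iff by blast+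
    thus "comp_sv ?G (- ?H) g = 0 \<or> comp_sv ?G (- ?H) g = R g"
      using fibre_zero[OF F, of g] by (cases "?G g = 0") (auto simp: comp_sv_apply)
  qed
  hence "comp_sv ?G (- ?H) \<le> ?G"
    by (intro wall_face_greatest covector_comp covector_uminus wall_face_covector)
      (simp_all add: comp_sv_apply wall_face_zero)
  thus ?thesis
    using assms(2) unfolding le_signvec_iff by (metis comp_sv_apply fun_Compl_def signum_uminus_eq_0_iff)
qed

text \<open>
  If the wall faces \<open>H\<close> of \<open>Q\<close> and \<open>G\<close> of \<open>R\<close> have the same zeros \<open>Z\<close>, then the covectors that contribute lie in
  the flat of \<open>Z\<close>, where \<open>H\<close> and \<open>G\<close> have full support. So \<open>euler_weight_fibre\<close> applies in
  this flat, on which \<open>s\<close> is an Euler weight up to the sign \<open>c\<close>. It is essential that \<open>c\<close> depends only on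
  \<open>Z\<close>: then the two entries at a pair of mirror images have the same sign.
\<close>

lemma wall_coeff_same_zeros:
  assumes s: "euler_weight L s" and Z: "Z \<subseteq> E"
  obtains c :: int where "c * c = 1"
    "\<And>Q R. {f \<in> E. wall_face L e Q f = 0} = Z \<Longrightarrow> {f \<in> E. wall_face L e R f = 0} = Z
      \<Longrightarrow> e \<in> E \<Longrightarrow> wall_coeff L s e Q R = (if R = mirror L e Q then c else 0)"
proof -
  let ?K = "slice L Z (\<lambda>_. 0)"
  obtain c :: int where c: "c * c = 1" "euler_weight ?K (\<lambda>F. c * s F)"
    using euler_weight_flat[OF s Z] .
  have "wall_coeff L s e Q R = (if R = mirror L e Q then c else 0)"
    if QZ: "{f \<in> E. wall_face L e Q f = 0} = Z" and RZ: "{f \<in> E. wall_face L e R f = 0} = Z"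
      and e: "e \<in> E" for Q R
  proof (cases "\<exists>F\<in>L. F e = 0 \<and> comp_sv F (- Q) = R")
    case False
    hence "{F. F \<in> L \<and> F e = 0 \<and> comp_sv F (- Q) = R} = {}"
      by blast
    hence "wall_coeff L s e Q R = 0"
      unfolding wall_coeff_def by (metis sum.empty)
    moreover have "R \<noteq> mirror L e Q"
    proof
      assume R: "R = mirror L e Q"
      have "wall_face L e Q \<in> L" "wall_face L e Q e = 0"
        by (rule wall_face_covector, rule wall_face_zero)
      thus False
        using False R unfolding mirror_def by blast
    qed
    ultimately show ?thesis
      by simp
  next
    case True
    let ?H = "wall_face L e Q" and ?G = "wall_face L e R"
    have H0: "?H f = 0 \<longleftrightarrow> f \<in> Z \<or> f \<notin> E" for f
      using QZ covector_outside[OF wall_face_covector] by blast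
    have G0: "?G f = 0 \<longleftrightarrow> f \<in> Z \<or> f \<notin> E" for f
      using RZ covector_outside[OF wall_face_covector] by blast
    have HQ: "?H f = Q f" if "?H f \<noteq> 0" for f
      using that wall_face_le[of e Q] unfolding le_signvec_iff by blast
    have GR: "?G f = R f" if "?G f \<noteq> 0" for f
      using that wall_face_le[of e R] unfolding le_signvec_iff by blast
    have RQ: "R f = - Q f" if "?G f = 0" for f
      using True fibre_zero that by blast
    have K0: "F f = 0" if "F \<in> ?K" "?G f = 0" for F f
      using that covector_outside[of F f] G0[of f] by (auto simp: slice_def)
    have fibre: "{F. F \<in> L \<and> F e = 0 \<and> comp_sv F (- Q) = R} = {F. F \<in> ?K \<and> comp_sv F (- ?H) = ?G}"
    proof (intro equalityI subsetI)
      fix F assume "F \<in> {F. F \<in> L \<and> F e = 0 \<and> comp_sv F (- Q) = R}"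
      hence F: "F \<in> L" "F e = 0" "comp_sv F (- Q) = R"
        by auto
      have "F \<le> ?G"
        by (rule wall_face_greatest[OF F(1) comp_sv_eq_imp_le[OF F(3)] F(2)])
      hence F0: "F f = 0" if "?G f = 0" for f
        using that unfolding le_signvec_iff by metis
      hence "comp_sv F (- ?H) f = ?G f" for f
        using F0[of f] GR[of f] HQ[of f] H0[of f] G0[of f] fun_cong[OF F(3), of f]
        by (cases "?G f = 0") (auto simp: comp_sv_apply)
      thus "F \<in> {F. F \<in> ?K \<and> comp_sv F (- ?H) = ?G}"
        using F(1) F0 G0 by (auto simp: slice_def)
    next
      fix F assume "F \<in> {F. F \<in> ?K \<and> comp_sv F (- ?H) = ?G}"
      hence F: "F \<in> ?K" "comp_sv F (- ?H) = ?G"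
        by auto
      have "comp_sv F (- Q) f = R f" for f
        using K0[OF F(1), of f] GR[of f] HQ[of f] H0[of f] G0[of f] RQ[of f] fun_cong[OF F(2), of f]
        by (cases "?G f = 0") (auto simp: comp_sv_apply)
      moreover have "F e = 0"
        using K0[OF F(1)] wall_face_zero by blast
      ultimately show "F \<in> {F. F \<in> L \<and> F e = 0 \<and> comp_sv F (- Q) = R}"
        using F(1) by (auto simp: slice_def)
    qed
    have "c * wall_coeff L s e Q R = (\<Sum>F | F \<in> ?K \<and> comp_sv F (- ?H) = ?G. c * s F)"
      unfolding wall_coeff_def fibre by (simp add: sum_distrib_left)
    also have "\<dots> = (if ?G = ?H then 1 else 0)"
    proof (rule euler_weight_fibre[OF c(2)])
      show "?H \<in> ?K"
        using wall_face_covector H0 by (simp add: slice_def)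
    qed (use H0 G0 K0 in auto)
    finally have "c * wall_coeff L s e Q R = (if ?G = ?H then 1 else 0)" .
    moreover have "wall_coeff L s e Q R = c * (c * wall_coeff L s e Q R)"
      using c(1) by (simp flip: mult.assoc)
    ultimately have "wall_coeff L s e Q R = c * (if ?G = ?H then 1 else 0)"
      by (simp only:)
    moreover have "?G = ?H \<longleftrightarrow> R = mirror L e Q"
    proof
      assume GH: "?G = ?H"
      show "R = mirror L e Q"
      proof (rule ext)
        fix f
        show "R f = mirror L e Q f"
          using RQ[of f] GR[of f] unfolding mirror_def GH
          by (cases "?H f = 0") (simp_all add: comp_sv_apply)
      qed
    next
      assume "R = mirror L e Q"
      thus "?G = ?H"
        by (simp add: wall_face_mirror)
    qed
    ultimately show ?thesis
      by simp
  qed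
  with c(1) that show ?thesis
    by blast
qed

end

section \<open>Factoring the Varchenko matrix of a cone\<close>

text \<open>
  The Varchenko matrix with the variables replaced by arbitrary ring elements.
\<close>

definition sep_weight :: "'e set \<Rightarrow> ('e \<Rightarrow> 'r::comm_ring_1) \<Rightarrow> 'e signvec \<Rightarrow> 'e signvec \<Rightarrow> 'r" where
  "sep_weight E u P Q = (\<Prod>e\<in>Sep E P Q. u e)"

definition tope_cone :: "'e signvec set \<Rightarrow> 'e set \<Rightarrow> 'e signvec \<Rightarrow> 'e signvec set" where
  "tope_cone L A \<sigma> = {T \<in> topes L. \<forall>a\<in>A. T a = \<sigma> a}"

text \<open>
  The integer factor is the coefficient of row \<open>R\<close> in the expansion of row \<open>Q\<close> by the
  rows on one side of the wall, up to the monomial that accounts for the passage from \<open>Q\<close> to \<open>R\<close>.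
\<close>

definition wall_matrix :: "'e set \<Rightarrow> 'e signvec set \<Rightarrow> ('e \<Rightarrow> 'r::comm_ring_1) \<Rightarrow> ('e signvec \<Rightarrow> int)
    \<Rightarrow> 'e \<Rightarrow> 'e signvec \<Rightarrow> 'e signvec \<Rightarrow> 'r" where
  "wall_matrix E L u s e Q R =
    of_int (\<Sum>F | F \<in> L \<and> F e \<noteq> 0 \<and> comp_sv F (- Q) = R. s F) * sep_weight E u Q R"

context oriented_matroid
begin

lemma finite_tope_cone: "finite (tope_cone L A \<sigma>)"
  using finite_covectors by (rule finite_subset[rotated]) (auto simp: tope_cone_def topes_def)

lemma sep_weight_tope:
  assumes "loopless E L" "Q \<in> topes L" "R \<in> topes L"
  shows "sep_weight E u Q R = (\<Prod>f\<in>E. if Q f = R f then 1 else u f)"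
proof -
  have "Q f = - R f \<and> Q f \<noteq> 0 \<longleftrightarrow> Q f \<noteq> R f" if "f \<in> E" for f
    using tope_nonzero[OF assms(1,2) that] tope_nonzero[OF assms(1,3) that]
      signum_opposite[of "Q f" "R f"] by (cases "Q f = R f") simp_all
  hence "Sep E Q R = {f \<in> E. Q f \<noteq> R f}"
    by (auto simp: Sep_def)
  hence "sep_weight E u Q R = (\<Prod>f | f \<in> E \<and> Q f \<noteq> R f. u f)"
    by (simp add: sep_weight_def)
  also have "\<dots> = (\<Prod>f\<in>E. if Q f \<noteq> R f then u f else 1)"
    by (rule prod.inter_filter[OF finite_ground])
  also have "\<dots> = (\<Prod>f\<in>E. if Q f = R f then 1 else u f)"
    by (rule prod.cong) auto
  finally show ?thesis .
qed

text \<open>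
  An element that separates \<open>Q\<close> from \<open>P\<close> separates \<open>R\<close> from exactly one of them; every other element separates
  \<open>R\<close> from both or from neither.
\<close>

lemma sep_weight_triangle:
  assumes loopless: "loopless E L" and T: "P \<in> topes L" "Q \<in> topes L" "R \<in> topes L"
  shows "sep_weight E u Q R * sep_weight E u R P
    = sep_weight E u Q P * (\<Prod>f | f \<in> E \<and> Q f = P f. if R f = Q f then 1 else (u f)\<^sup>2)"
proof -
  have eq: "(if Q f = R f then 1 else u f) * (if R f = P f then 1 else u f)
      = (if Q f = P f then 1 else u f) * (if Q f = P f then if R f = Q f then 1 else (u f)\<^sup>2 else 1)"
    if f: "f \<in> E" for f
  proof (cases "Q f = P f")
    case True
    thus ?thesis
      by (auto simp: power2_eq_square)
  next
    case False
    note nz = T[THEN tope_nonzero[OF loopless _ f]]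
    have "R f = Q f \<or> R f = P f"
      using signum_opposite[of "R f" "P f"] signum_opposite[of "Q f" "P f"] nz False by metis
    thus ?thesis
      using False by auto
  qed
  have "sep_weight E u Q R * sep_weight E u R P = sep_weight E u Q P *
      (\<Prod>f\<in>E. if Q f = P f then if R f = Q f then 1 else (u f)\<^sup>2 else 1)"
    unfolding sep_weight_tope[OF loopless T(2,3)] sep_weight_tope[OF loopless T(3,1)]
      sep_weight_tope[OF loopless T(2,1)] prod.distrib[symmetric]
    by (rule prod.cong[OF refl eq])
  also have "(\<Prod>f\<in>E. if Q f = P f then if R f = Q f then 1 else (u f)\<^sup>2 else 1)
      = (\<Prod>f | f \<in> E \<and> Q f = P f. if R f = Q f then 1 else (u f)\<^sup>2)"
    by (rule prod.inter_filter[OF finite_ground, symmetric])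
  finally show ?thesis .
qed

text \<open>
  Grouping the covectors \<open>F\<close> of the half cone of \<open>P\<close> by the tope \<open>R = F \<circ> (-Q)\<close> turns the right
  hand side into a sum over \<open>F\<close>. By \<open>sep_weight_triangle\<close> each summand is \<open>V Q P\<close> times \<open>s F\<close> and the squares
  of the variables of those elements where \<open>Q\<close> and \<open>P\<close> agree and \<open>F\<close> does not; these add up to
  \<open>1\<close> by \<open>euler_weight_mixed_sum\<close>. Composing with \<open>-Q\<close> and not with \<open>Q\<close> matters: \<open>F \<circ> (-Q)\<close> agrees with \<open>Q\<close> at
  \<open>f\<close> only if \<open>F\<close> does, which is a condition that prescribes a nonzero sign.
\<close>

lemma wall_matrix_factorization:
  assumes loopless: "loopless E L" and s: "euler_weight L s"
    and \<sigma>: "\<And>a. a \<in> A \<Longrightarrow> \<sigma> a \<noteq> 0" and e: "e \<in> E"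
    and P: "P \<in> tope_cone L A \<sigma>" and Q: "Q \<in> tope_cone L A \<sigma>"
  shows "sep_weight E u Q P = (\<Sum>R\<in>tope_cone L A \<sigma>.
    wall_matrix E L u s e Q R * (if R e = P e then sep_weight E u R P else 0))"
proof -
  let ?C = "tope_cone L A \<sigma>" and ?V = "sep_weight E u"
  let ?S = "{R \<in> ?C. R e = P e}"
  have tope: "T \<in> topes L" if "T \<in> ?C" for T
    using that by (simp add: tope_cone_def)
  have PQ: "P \<in> topes L" "Q \<in> topes L" "\<And>a. a \<in> A \<Longrightarrow> P a = \<sigma> a" "\<And>a. a \<in> A \<Longrightarrow> Q a = \<sigma> a"
    using P Q by (auto simp: tope_cone_def)
  have Pe: "P e \<noteq> 0"
    using tope_nonzero[OF loopless PQ(1) e] .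
  \<comment> \<open>The half cone of \<open>P\<close>; on \<open>A\<close> the signs of \<open>P\<close> are those of \<open>\<sigma>\<close>.\<close>
  define K where "K = slice L (insert e A) P"
  have K: "F \<in> K \<longleftrightarrow> F \<in> L \<and> F e = P e \<and> (\<forall>a\<in>A. F a = \<sigma> a)" for F
    using PQ(3) by (auto simp: K_def slice_def)
  have w: "euler_weight K s"
  proof -
    have "P b \<noteq> 0" if "b \<in> insert e A" for b
      using that Pe \<sigma> PQ(3) by auto
    thus ?thesis
      using euler_weight_upper[of "{}" P s P "insert e A"] s by (simp add: K_def slice_def)
  qed
  have maps: "(\<lambda>F. comp_sv F (- Q)) ` K \<subseteq> ?S"
  proof (rule image_subsetI)
    fix F assume F: "F \<in> K"
    have "comp_sv F (- Q) \<in> topes L"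
      using F K comp_uminus_tope[OF loopless _ PQ(2)] by blast
    thus "comp_sv F (- Q) \<in> ?S"
      using F Pe \<sigma> by (simp add: tope_cone_def K comp_sv_apply)
  qed
  have fibre: "{F \<in> K. comp_sv F (- Q) = R} = {F. F \<in> L \<and> F e \<noteq> 0 \<and> comp_sv F (- Q) = R}"
    if R: "R \<in> ?S" for R
  proof (intro equalityI subsetI)
    fix F assume "F \<in> {F \<in> K. comp_sv F (- Q) = R}"
    thus "F \<in> {F. F \<in> L \<and> F e \<noteq> 0 \<and> comp_sv F (- Q) = R}"
      using Pe by (auto simp: K)
  next
    fix F assume "F \<in> {F. F \<in> L \<and> F e \<noteq> 0 \<and> comp_sv F (- Q) = R}"
    hence F: "F \<in> L" "F e \<noteq> 0" "comp_sv F (- Q) = R"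
      by auto
    have "F a = \<sigma> a" if a: "a \<in> A" for a
      using fun_cong[OF F(3), of a] R PQ(4)[OF a] \<sigma>[OF a] a
      by (cases "F a = 0") (auto simp: comp_sv_apply tope_cone_def)
    moreover have "F e = P e"
      using fun_cong[OF F(3), of e] R F(2) by (simp add: comp_sv_apply)
    ultimately show "F \<in> {F \<in> K. comp_sv F (- Q) = R}"
      using F by (simp add: K)
  qed
  have "(\<Sum>R\<in>?C. wall_matrix E L u s e Q R * (if R e = P e then ?V R P else 0))
      = (\<Sum>R\<in>?S. wall_matrix E L u s e Q R * ?V R P)"
    unfolding sum.inter_filter[OF finite_tope_cone] by (rule sum.cong) auto
  also have "\<dots> = (\<Sum>R\<in>?S. \<Sum>F\<in>{F \<in> K. comp_sv F (- Q) = R}.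
      of_int (s F) * (?V Q (comp_sv F (- Q)) * ?V (comp_sv F (- Q)) P))"
  proof (rule sum.cong[OF refl])
    fix R assume "R \<in> ?S"
    hence "wall_matrix E L u s e Q R * ?V R P
        = (\<Sum>F\<in>{F \<in> K. comp_sv F (- Q) = R}. of_int (s F) * (?V Q R * ?V R P))"
      by (simp add: wall_matrix_def fibre[symmetric] sum_distrib_right mult.assoc)
    also have "\<dots> = (\<Sum>F\<in>{F \<in> K. comp_sv F (- Q) = R}.
        of_int (s F) * (?V Q (comp_sv F (- Q)) * ?V (comp_sv F (- Q)) P))"
      by (rule sum.cong) auto
    finally show "wall_matrix E L u s e Q R * ?V R P
        = (\<Sum>F\<in>{F \<in> K. comp_sv F (- Q) = R}.
            of_int (s F) * (?V Q (comp_sv F (- Q)) * ?V (comp_sv F (- Q)) P))" .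
  qed
  also have "\<dots> = (\<Sum>F\<in>K. of_int (s F) * (?V Q (comp_sv F (- Q)) * ?V (comp_sv F (- Q)) P))"
    by (rule sum.group[OF _ _ maps]) (simp_all add: K_def finite_slice finite_tope_cone)
  also have "\<dots> = (\<Sum>F\<in>K. ?V Q P * (of_int (s F) *
      (\<Prod>f | f \<in> E \<and> Q f = P f. if F f = Q f then 1 else (u f)\<^sup>2)))"
  proof (rule sum.cong[OF refl])
    fix F assume F: "F \<in> K"
    have "comp_sv F (- Q) f = Q f \<longleftrightarrow> F f = Q f" if "f \<in> E" for f
      using tope_nonzero[OF loopless PQ(2) that] by (auto simp: comp_sv_apply)
    hence "(\<Prod>f | f \<in> E \<and> Q f = P f. if comp_sv F (- Q) f = Q f then 1 else (u f)\<^sup>2)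
        = (\<Prod>f | f \<in> E \<and> Q f = P f. if F f = Q f then 1 else (u f)\<^sup>2)"
      by (intro prod.cong refl if_cong) blast
    moreover have "comp_sv F (- Q) \<in> topes L"
      using maps F tope by blast
    ultimately show "of_int (s F) * (?V Q (comp_sv F (- Q)) * ?V (comp_sv F (- Q)) P)
        = ?V Q P * (of_int (s F) * (\<Prod>f | f \<in> E \<and> Q f = P f. if F f = Q f then 1 else (u f)\<^sup>2))"
      by (simp add: sep_weight_triangle[OF loopless PQ(1,2)] mult_ac)
  qed
  also have "\<dots> = ?V Q P * (\<Sum>F\<in>K. of_int (s F) *
      (\<Prod>f | f \<in> E \<and> Q f = P f. if F f = Q f then 1 else (u f)\<^sup>2))"
    by (rule sum_distrib_left[symmetric])
  also have "(\<Sum>F\<in>K. of_int (s F) * (\<Prod>f | f \<in> E \<and> Q f = P f. if F f = Q f then 1 else (u f)\<^sup>2))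
      = (\<Prod>f | f \<in> E \<and> Q f = P f. 1)"
    unfolding K_def
  proof (rule euler_weight_mixed_sum)
    show "euler_weight (slice L (insert e A) P) s"
      using w by (simp add: K_def)
    show "P \<in> slice L (insert e A) P"
      using tope_covector[OF PQ(1)] by (simp add: slice_def)
    show "Q f \<noteq> 0" if "f \<in> {f \<in> E. Q f = P f}" for f
      using tope_nonzero[OF loopless PQ(2)] that by blast
  qed (use finite_ground in auto)
  finally show ?thesis
    by simp
qed

text \<open>
  The wall matrix is block triangular with respect to the number of zeros of the wall face, with a
  block for every pair of mirror images. The off-diagonal entries of such a block are both \<open>a(G)\<close> up to the same
  sign, where \<open>G\<close> is the common wall face. Mirror images that both lie in the cone agree on \<open>A\<close>, so
  \<open>G\<close> has no zero there.
\<close>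

lemma power_product_det_wall_matrix:
  assumes loopless: "loopless E L" and s: "euler_weight L s"
    and \<sigma>: "\<And>a. a \<in> A \<Longrightarrow> \<sigma> a \<noteq> 0" and e: "e \<in> E"
  shows "power_product {F \<in> L. \<forall>a\<in>A. F a \<noteq> 0} (\<lambda>F. 1 - (\<Prod>f | f \<in> E \<and> F f = 0. u f)\<^sup>2)
    (det_on (tope_cone L A \<sigma>) (wall_matrix E L u s e))"
proof -
  let ?C = "tope_cone L A \<sigma>"
  let ?Z = "\<lambda>R. {f \<in> E. wall_face L e R f = 0}"
  let ?a = "\<lambda>R. \<Prod>f\<in>?Z R. u f"
  let ?M = "wall_matrix E L u s e"
  have tope: "T \<in> topes L" if "T \<in> ?C" for T
    using that by (simp add: tope_cone_def)
  have M: "?M Q R = of_int ((if R = Q then 1 else 0) - wall_coeff L s e Q R) * sep_weight E u Q R"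
    if "Q \<in> ?C" "R \<in> ?C" for Q R
    using off_wall_coeff[OF loopless s tope[OF that(1)] tope[OF that(2)], of e]
    by (simp add: wall_matrix_def)
  have Ze: "e \<in> ?Z R" for R
    using e wall_face_zero by simp
  have mirror_opp: "mirror L e R f = - R f" if "f \<in> ?Z R" for R f
    using that by (simp add: mirror_def comp_sv_apply)
  have mirror_neq: "mirror L e R \<noteq> R" if "R \<in> topes L" for R
    using mirror_opp[OF Ze, of R] tope_nonzero[OF loopless that e] by auto
  have Z_mirror: "?Z (mirror L e R) = ?Z R" for R
    by (simp add: wall_face_mirror)
  have same: "wall_coeff L s e Q R = 0"
    if "?Z Q = ?Z R" "R \<noteq> mirror L e Q" for Q R
  proof -
    obtain c :: int where "\<And>Q' R'. ?Z Q' = ?Z Q \<Longrightarrow> ?Z R' = ?Z Q \<Longrightarrow> e \<in> E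
        \<Longrightarrow> wall_coeff L s e Q' R' = (if R' = mirror L e Q' then c else 0)"
      by (rule wall_coeff_same_zeros[OF s, of "?Z Q" e]) auto
    from this[OF refl that(1)[symmetric] e] show ?thesis
      using that(2) by simp
  qed
  have entry: "?M R (mirror L e R) = - of_int (wall_coeff L s e R (mirror L e R)) * ?a R"
    if "R \<in> ?C" "mirror L e R \<in> ?C" for R
  proof -
    note R = tope[OF that(1)]
    have "R f = - mirror L e R f \<and> R f \<noteq> 0 \<longleftrightarrow> wall_face L e R f = 0" if f: "f \<in> E" for f
    proof (cases "wall_face L e R f = 0")
      case True
      thus ?thesis
        using tope_nonzero[OF loopless R f] mirror_opp[of f R] f by simp
    next
      case False
      hence "mirror L e R f = R f"
        using wall_face_le[of e R] unfolding le_signvec_iff mirror_def comp_sv_apply by metis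
      thus ?thesis
        using False by auto
    qed
    hence "Sep E R (mirror L e R) = ?Z R"
      by (auto simp: Sep_def)
    thus ?thesis
      using mirror_neq[OF R] by (simp add: M[OF that] sep_weight_def)
  qed
  show ?thesis
  proof (rule power_product_det_on_paired[where m="mirror L e" and z="\<lambda>R. card (?Z R)"])
    show "finite ?C"
      by (rule finite_tope_cone)
  next
    fix R assume R: "R \<in> ?C"
    \<comment> \<open>A covector in the wall would give \<open>R e = - R e\<close>.\<close>
    have "{F. F \<in> L \<and> F e = 0 \<and> comp_sv F (- R) = R} = {}"
      using tope_nonzero[OF loopless tope[OF R] e] by (auto simp: fun_eq_iff comp_sv_apply)
    hence "wall_coeff L s e R R = 0"
      unfolding wall_coeff_def by (metis sum.empty)
    moreover have "sep_weight E u R R = 1"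
      by (simp add: sep_weight_tope[OF loopless tope[OF R] tope[OF R]])
    ultimately show "?M R R = 1"
      by (simp add: M[OF R R])
  next
    fix Q R assume QR: "Q \<in> ?C" "R \<in> ?C" "R \<noteq> Q" "R \<noteq> mirror L e Q" "?M Q R \<noteq> 0"
    hence nz: "wall_coeff L s e Q R \<noteq> 0"
      by (auto simp: M)
    hence "?Z R \<subseteq> ?Z Q"
      using wall_coeff_zeros by blast
    moreover have "?Z R \<noteq> ?Z Q"
      using same[of Q R] QR(4) nz by metis
    ultimately show "card (?Z R) < card (?Z Q)"
      using finite_ground by (intro psubset_card_mono) auto
  next
    fix R assume R: "R \<in> ?C" "mirror L e R \<in> ?C"
    obtain c :: int where c: "c * c = 1" "\<And>Q' R'. ?Z Q' = ?Z R \<Longrightarrow> ?Z R' = ?Z R \<Longrightarrow> e \<in> E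
        \<Longrightarrow> wall_coeff L s e Q' R' = (if R' = mirror L e Q' then c else 0)"
      by (rule wall_coeff_same_zeros[OF s, of "?Z R" e]) auto
    have "?M R (mirror L e R) = - of_int c * ?a R"
      using entry[OF R] c(2)[OF refl Z_mirror e] by simp
    moreover have "?M (mirror L e R) R = - of_int c * ?a R"
      using entry[of "mirror L e R"] R c(2)[OF Z_mirror refl e]
      by (simp add: Z_mirror mirror_mirror)
    ultimately have "?M R (mirror L e R) * ?M (mirror L e R) R = of_int (c * c) * (?a R)\<^sup>2"
      by (simp add: power2_eq_square mult_ac)
    hence eq: "1 - ?M R (mirror L e R) * ?M (mirror L e R) R = 1 - (?a R)\<^sup>2"
      using c(1) by simp
    have "wall_face L e R a \<noteq> 0" if a: "a \<in> A" for a
    proof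
      assume "wall_face L e R a = 0"
      hence "mirror L e R a = - R a"
        by (simp add: mirror_def comp_sv_apply)
      thus False
        using R a \<sigma>[OF a] by (auto simp: tope_cone_def)
    qed
    hence "wall_face L e R \<in> {F \<in> L. \<forall>a\<in>A. F a \<noteq> 0}"
      using wall_face_covector by blast
    moreover have "finite {F \<in> L. \<forall>a\<in>A. F a \<noteq> 0}"
      using finite_covectors by simp
    ultimately show "power_product {F \<in> L. \<forall>a\<in>A. F a \<noteq> 0}
        (\<lambda>F. 1 - (\<Prod>f | f \<in> E \<and> F f = 0. u f)\<^sup>2)
        (1 - ?M R (mirror L e R) * ?M (mirror L e R) R)"
      unfolding eq by (intro power_product_factor)
  qed (auto simp: mirror_mirror wall_face_mirror mirror_neq[OF tope])
qed

lemma power_product_det_tope_cone: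
  assumes loopless: "loopless E L"
    and "A \<subseteq> E" "\<And>a. a \<in> A \<Longrightarrow> \<sigma> a \<noteq> 0"
  shows "power_product {F \<in> L. \<forall>a\<in>A. F a \<noteq> 0} (\<lambda>F. 1 - (\<Prod>f | f \<in> E \<and> F f = 0. u f)\<^sup>2)
    (det_on (tope_cone L A \<sigma>) (sep_weight E u))"
  using assms(2,3)
proof (induction "card (E - A)" arbitrary: A \<sigma> rule: less_induct)
  case less
  let ?V = "sep_weight E u"
  let ?C = "tope_cone L A \<sigma>"
  let ?S = "\<lambda>A. {F \<in> L. \<forall>a\<in>A. F a \<noteq> 0}"
  let ?f = "\<lambda>F. 1 - (\<Prod>f | f \<in> E \<and> F f = 0. u f)\<^sup>2"
  show ?case
  proof (cases "A = E")
    case True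
    have eq: "P = Q" if "P \<in> ?C" "Q \<in> ?C" for P Q
    proof (rule ext)
      fix f
      show "P f = Q f"
        using that covector_outside[of P f] covector_outside[of Q f]
        by (cases "f \<in> E") (auto simp: tope_cone_def topes_def True)
    qed
    show ?thesis
    proof (cases "?C = {}")
      case True
      thus ?thesis
        by (simp add: power_product_1)
    next
      case False
      then obtain P where P: "P \<in> ?C"
        by blast
      hence "?C = {P}"
        using eq by blast
      moreover have "?V P P = 1"
        using P by (simp add: sep_weight_tope[OF loopless] tope_cone_def)
      ultimately show ?thesis
        by (simp add: power_product_1)
    qed
  next
    case False
    then obtain e where e: "e \<in> E" "e \<notin> A"
      using less.prems(1) by blast
    obtain s where s: "euler_weight L s"
      using euler_weight_exists[OF finite_covectors] by blast
    \<comment> \<open>The block diagonal factor; \<open>?H Pos\<close> and \<open>?H Neg\<close> are the half cones.\<close>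
    let ?D = "\<lambda>R P. if R e = P e then ?V R P else 0"
    let ?H = "\<lambda>t. tope_cone L (insert e A) (\<sigma>(e := t))"
    have H: "?H t = {P \<in> ?C. P e = t}" for t
      using e by (auto simp: tope_cone_def)
    have half: "power_product (?S A) ?f (det_on (?H t) ?D)" if t: "t \<noteq> 0" for t
    proof -
      have "det_on (?H t) ?D = det_on (?H t) ?V"
        by (rule det_on_cong) (simp add: H)
      moreover have "card (E - insert e A) < card (E - A)"
        using e finite_ground by (intro psubset_card_mono) auto
      hence "power_product (?S (insert e A)) ?f (det_on (?H t) ?V)"
        using e t less.prems by (intro less.hyps) auto
      hence "power_product (?S A) ?f (det_on (?H t) ?V)"
        by (rule power_product_mono) (use finite_covectors in auto)
      ultimately show ?thesis
        by simp
    qed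
    have "?C - ?H Pos = ?H Neg"
      unfolding H using tope_nonzero[OF loopless _ e(1)] signum_trichotomy
      by (auto simp: tope_cone_def)
    moreover have "det_on ?C ?D = det_on (?H Pos) ?D * det_on (?C - ?H Pos) ?D"
      by (rule det_on_block_triangular[OF finite_tope_cone]) (auto simp: H)
    ultimately have D: "power_product (?S A) ?f (det_on ?C ?D)"
      using half[of Pos] half[of Neg] by (simp add: power_product_mult)
    have "det_on ?C ?V = det_on ?C (\<lambda>Q P. \<Sum>R\<in>?C. wall_matrix E L u s e Q R * ?D R P)"
      by (intro det_on_cong wall_matrix_factorization loopless s less.prems(2) e(1))
    also have "\<dots> = det_on ?C (wall_matrix E L u s e) * det_on ?C ?D"
      by (rule det_on_mult[OF finite_tope_cone])
    finally have "det_on ?C ?V = det_on ?C (wall_matrix E L u s e) * det_on ?C ?D" .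
    moreover have "power_product (?S A) ?f (det_on ?C (wall_matrix E L u s e))"
      by (rule power_product_det_wall_matrix[OF loopless s _ e(1)]) (rule less.prems(2))
    ultimately show ?thesis
      using D by (simp add: power_product_mult)
  qed
qed

end

section \<open>The determinant of a closed supertope\<close>

theorem corollary5p8:
  fixes E E' :: "'e set"
    and L :: "'e signvec set"
    and eps :: "'e \<Rightarrow> signum"
  assumes "oriented_matroid E L"
    and "loopless E L"
    and "E' \<noteq> {}"
    and "E' \<subseteq> E"
    and "\<forall>e\<in>E'. eps e \<in> {Pos, Neg}"
    and "closed_supertope E L {e \<in> E'. eps e = Pos} {e \<in> E'. eps e = Neg}"
  shows "\<exists>b :: 'e signvec \<Rightarrow> nat.
    det_on {P \<in> topes L. \<forall>e\<in>E'. P e = eps e}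
      (varchenko E :: 'e signvec \<Rightarrow> 'e signvec \<Rightarrow> ('e, 'k::field) mpoly)
    = (\<Prod>F \<in> {F \<in> L. \<forall>e\<in>E'. F e \<noteq> 0}. (1 - (a_poly E F)\<^sup>2) ^ b F)"
proof -
  interpret oriented_matroid E L
    by fact
  have "sep_weight E var_U = (varchenko E :: _ \<Rightarrow> _ \<Rightarrow> ('e, 'k) mpoly)"
    by (simp add: fun_eq_iff sep_weight_def varchenko_def)
  moreover have "eps e \<noteq> 0" if "e \<in> E'" for e
    using assms(5) that by auto
  ultimately show ?thesis
    using power_product_det_tope_cone[OF assms(2,4), of eps "var_U :: 'e \<Rightarrow> ('e, 'k) mpoly"]
    by (simp add: power_product_def tope_cone_def a_poly_def)
qed

end
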